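(* Let $A=(Q,\Sigma,q_0,q_f,\delta)$ be an $\varepsilon$NFA with $n=|Q|$ states and $m=|\delta|$ transitions, and let $w\in\Sigma^*$. There are algorithms that solve the subsequence matching problem (decide whether some subsequence of $w$ is in $\mathcal{L}(A)$) in time $O(|w|+n|\Sigma|\cdot(n|\Sigma|+m))$ and the supersequence matching problem (decide whether some supersequence of $w$ is in $\mathcal{L}(A)$) in time $O(|w|+n|\Sigma|\,m)$.
   Context: An $\varepsilon$NFA is a tuple $A=(Q,\Sigma,q_0,q_f,\delta)$ with finite state set $Q$, finite alphabet $\Sigma$, a single initial state $q_0$, a single final state $q_f$, and transitions $\delta\subseteq Q\times(\Sigma\cup\{\varepsilon\})\times Q$; $\mathcal{L}(A)$ is the set of strings labelling (ignoring $\varepsilon$) a path from $q_0$ to $q_f$. Standing assumptions: $A$ is trimmed (every state is reachable from $q_0$ and can reach $q_f$) and every symbol of $\Sigma$ labels at least one transition. A string $u$ is a subsequence of $w$ if $u=w[j_1]\cdots w[j_{|u|}]$ for some $1\le j_1<\dots<j_{|u|}\le|w|$; $u$ is a supersequence of $w$ if $w$ is a subsequence of $u$. Model: unit-cost word RAM with logarithmic word size, integer alphabet $\Sigma=\{1,\dots,|\Sigma|\}$, $Q=\{1,\dots,n\}$. *)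

theory Defs
  imports Complex_Main "HOL-Library.Sublist"
begin

section \<open>Finite automata with empty transitions\<close>

text \<open>A transition label \<^term>\<open>None\<close> stands for the empty string.\<close>

record ('q, 'a) enfa =
  states :: "'q set"
  alphabet :: "'a set"
  init :: 'q
  final :: 'q
  trans :: "('q \<times> 'a option \<times> 'q) set"

definition enfa :: "('q, 'a) enfa \<Rightarrow> bool" where
  "enfa A \<longleftrightarrow>
     finite (states A) \<and> finite (alphabet A) \<and>
     init A \<in> states A \<and> final A \<in> states A \<and>
     trans A \<subseteq> states A \<times> insert None (Some ` alphabet A) \<times> states A"

inductive path :: "('q, 'a) enfa \<Rightarrow> 'q \<Rightarrow> 'a list \<Rightarrow> 'q \<Rightarrow> bool" for A where
  Nil: "path A q [] q"
| Eps: "(p, None, q) \<in> trans A \<Longrightarrow> path A q u r \<Longrightarrow> path A p u r"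
| Sym: "(p, Some a, q) \<in> trans A \<Longrightarrow> path A q u r \<Longrightarrow> path A p (a # u) r"

definition lang :: "('q, 'a) enfa \<Rightarrow> 'a list set" where
  "lang A = {u. path A (init A) u (final A)}"

definition trimmed :: "('q, 'a) enfa \<Rightarrow> bool" where
  "trimmed A \<longleftrightarrow>
     (\<forall>q \<in> states A. (\<exists>u. path A (init A) u q) \<and> (\<exists>v. path A q v (final A)))"

definition all_symbols_used :: "('q, 'a) enfa \<Rightarrow> bool" where
  "all_symbols_used A \<longleftrightarrow> (\<forall>a \<in> alphabet A. \<exists>p q. (p, Some a, q) \<in> trans A)"

definition subsequence_matching :: "('q, 'a) enfa \<Rightarrow> 'a list \<Rightarrow> bool" where
  "subsequence_matching A w \<longleftrightarrow> (\<exists>u. subseq u w \<and> u \<in> lang A)"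

definition supersequence_matching :: "('q, 'a) enfa \<Rightarrow> 'a list \<Rightarrow> bool" where
  "supersequence_matching A w \<longleftrightarrow> (\<exists>u. subseq w u \<and> u \<in> lang A)"


section \<open>The unit-cost word RAM\<close>

text \<open>Words of \<open>b\<close> bits are the natural numbers below \<open>2 ^ b\<close>, and every computed
  value is reduced modulo \<open>2 ^ b\<close>. The word size is a parameter of the semantics and not
  a type, since it depends on the input. A program is a finite list of instructions, so it
  mentions only finitely many of the registers; the memory is addressed by words held in
  registers. Jump targets are absolute, and the machine halts when the program counter
  leaves the program.\<close>

datatype binop = Add | Sub | Mul | Div | Mod | And | Or | Xor | Shl | Shr

datatype instr =
    Const nat nat
  | Op binop nat nat nat
  | Load nat nat
  | Store nat nat
  | Jump nat
  | JumpEq nat nat nat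
  | JumpLess nat nat nat

type_synonym program = "instr list"

record config =
  pc :: nat
  reg :: "nat \<Rightarrow> nat"
  mem :: "nat \<Rightarrow> nat"

text \<open>Subtraction wraps around (the arguments are words). Division by zero follows the
  conventions of HOL.\<close>

fun eval_op :: "nat \<Rightarrow> binop \<Rightarrow> nat \<Rightarrow> nat \<Rightarrow> nat" where
  "eval_op b Add x y = (x + y) mod 2 ^ b"
| "eval_op b Sub x y = (x + 2 ^ b - y) mod 2 ^ b"
| "eval_op b Mul x y = (x * y) mod 2 ^ b"
| "eval_op b Div x y = (x div y) mod 2 ^ b"
| "eval_op b Mod x y = (x mod y) mod 2 ^ b"
| "eval_op b And x y = and x y mod 2 ^ b"
| "eval_op b Or x y = or x y mod 2 ^ b"
| "eval_op b Xor x y = xor x y mod 2 ^ b"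
| "eval_op b Shl x y = push_bit y x mod 2 ^ b"
| "eval_op b Shr x y = drop_bit y x mod 2 ^ b"

fun exec :: "nat \<Rightarrow> instr \<Rightarrow> config \<Rightarrow> config" where
  "exec b (Const i c) s = s\<lparr>pc := pc s + 1, reg := (reg s)(i := c mod 2 ^ b)\<rparr>"
| "exec b (Op f i j k) s =
     s\<lparr>pc := pc s + 1, reg := (reg s)(i := eval_op b f (reg s j) (reg s k))\<rparr>"
| "exec b (Load i j) s = s\<lparr>pc := pc s + 1, reg := (reg s)(i := mem s (reg s j))\<rparr>"
| "exec b (Store i j) s = s\<lparr>pc := pc s + 1, mem := (mem s)(reg s i := reg s j)\<rparr>"
| "exec b (Jump l) s = s\<lparr>pc := l\<rparr>"
| "exec b (JumpEq i j l) s = s\<lparr>pc := (if reg s i = reg s j then l else pc s + 1)\<rparr>"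
| "exec b (JumpLess i j l) s = s\<lparr>pc := (if reg s i < reg s j then l else pc s + 1)\<rparr>"

definition halted :: "program \<Rightarrow> config \<Rightarrow> bool" where
  "halted P s \<longleftrightarrow> length P \<le> pc s"

definition step :: "nat \<Rightarrow> program \<Rightarrow> config \<Rightarrow> config" where
  "step b P s = (if halted P s then s else exec b (P ! pc s) s)"

definition initial :: "nat list \<Rightarrow> config" where
  "initial xs =
     \<lparr>pc = 0, reg = (\<lambda>_. 0), mem = (\<lambda>i. if i < length xs then xs ! i else 0)\<rparr>"

text \<open>The answer is read off register 0: 1 for yes and 0 for no.\<close>

definition answers_within :: "nat \<Rightarrow> program \<Rightarrow> nat list \<Rightarrow> nat \<Rightarrow> bool \<Rightarrow> bool" where
  "answers_within b P xs T ans \<longleftrightarrow>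
     (\<exists>t \<le> T. let s = (step b P ^^ t) (initial xs)
              in halted P s \<and> reg s 0 = (if ans then 1 else 0))"


section \<open>Matching problems on the word RAM\<close>

text \<open>The transitions are given as a list \<open>ts\<close>, in arbitrary order and without
  repetitions. The empty label is encoded as 0, which is not a symbol.\<close>

definition matching_instance ::
    "(nat, nat) enfa \<Rightarrow> (nat \<times> nat option \<times> nat) list \<Rightarrow> nat list \<Rightarrow> bool" where
  "matching_instance A ts w \<longleftrightarrow>
     enfa A \<and> trimmed A \<and> all_symbols_used A \<and>
     states A = {1..card (states A)} \<and> alphabet A = {1..card (alphabet A)} \<and>
     distinct ts \<and> set ts = trans A \<and> w \<in> lists (alphabet A)"

fun encode_transition :: "nat \<times> nat option \<times> nat \<Rightarrow> nat list" where
  "encode_transition (p, x, q) = [p, case x of None \<Rightarrow> 0 | Some a \<Rightarrow> a, q]"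

definition encode_instance ::
    "(nat, nat) enfa \<Rightarrow> (nat \<times> nat option \<times> nat) list \<Rightarrow> nat list \<Rightarrow> nat list" where
  "encode_instance A ts w =
     [card (states A), card (alphabet A), length ts, length w, init A, final A]
     @ concat (map encode_transition ts) @ w"

text \<open>\<open>solvable_in_O problem T\<close>: a single program decides \<open>problem\<close> in
  \<open>O(T n \<sigma> m l)\<close> steps, for \<open>n\<close> states, \<open>\<sigma>\<close> symbols, \<open>m\<close> transitions and a string
  of length \<open>l\<close>. The word size \<open>b\<close> is only required to be at least some constant multiple
  of the logarithm of the number of input words; in particular the program cannot rely on
  words that are longer than logarithmic. The maximum with 1 concerns only the empty
  alphabet, where the time bounds of interest are 0 although the answer ``yes'' takes at
  least one step; for nonempty alphabets these bounds are positive, since each symbol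
  labels a transition.\<close>

definition solvable_in_O ::
    "((nat, nat) enfa \<Rightarrow> nat list \<Rightarrow> bool) \<Rightarrow> (nat \<Rightarrow> nat \<Rightarrow> nat \<Rightarrow> nat \<Rightarrow> nat) \<Rightarrow> bool" where
  "solvable_in_O problem T \<longleftrightarrow>
     (\<exists>(P :: program) (c :: nat) (d :: nat). \<forall>A ts w (b :: nat).
        matching_instance A ts w \<longrightarrow>
        real d * log 2 (real (length (encode_instance A ts w))) \<le> real b \<longrightarrow>
        answers_within b P (encode_instance A ts w)
          (c * max 1 (T (card (states A)) (card (alphabet A)) (card (trans A)) (length w)))
          (problem A w))"

end

theory Submission
  imports Defs
begin

text \<open>Let \<open>S\<close> be the set of states that are reachable by some subsequence (respectively, some
  supersequence) of the prefix of \<open>w\<close> that has been read. Reading a letter can only enlarge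
  (respectively, shrink) \<open>S\<close>, so \<open>S\<close> changes at most \<open>n\<close> times. Between two changes it suffices to
  recompute \<open>S\<close> once per letter, because a letter that has left \<open>S\<close> unchanged can be marked and
  skipped until the next change. That makes \<open>O(n |\<Sigma>|)\<close> recomputations, each a graph search in time
  \<open>O(m)\<close>, plus constant time per letter of \<open>w\<close>; both time bounds follow, the one for
  subsequences with room to spare.\<close>

text \<open>The old set survives a step for subsequences because the letter may be dropped. For
  supersequences the set is closed under all transitions and so already contains its successors
  under any letter. Hence a mark stays valid as long as the set does.

  At most \<open>n\<close> recomputations change the set, and between two changes at most \<sigma> =
  |\<Sigma>| of them mark a letter, which gives at most \<sigma> + (\<sigma> + 1) n \<le> 3 n
  \<sigma> in total. One of them also scans all states and may clear all marks; this is still O(m),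
  since trimmedness gives n \<le> m + 1 and the use of every symbol gives \<sigma> \<le> m.

  The claim is about a concrete machine program with logarithmic words, so the program is written in
  a small language whose clock counts machine instructions and whose semantics rules out overflow.
  Words of at least 3 log N bits give N^3 \<le> 2^b for an input of N cells, which is enough to
  address seven arrays of that size. The empty alphabet is handled apart, because only constant time
  is available there.\<close>

section \<open>A while language with arrays\<close>

text \<open>\<open>Cur\<close> holds the current state set and \<open>New\<close> its candidate successor, \<open>Mark\<close> the letters known
  to leave \<open>Cur\<close> unchanged, \<open>Head\<close> and \<open>Nxt\<close> the linked lists of the transitions out of each state,
  and \<open>Stk\<close> the states that the search has yet to expand.\<close>

datatype var = Ans | NumQ | TrEnd | InEnd | Edge | St | Sp | Pos | Sym | Chg
datatype arr = Inp | Cur | New | Mark | Head | Nxt | Stk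

datatype aexp = C nat | V var | Plus aexp aexp | Minus aexp aexp | Rd arr aexp
datatype cond = Less aexp aexp | Eq aexp aexp
datatype com =
    Skip
  | Assign var aexp
  | Write arr aexp aexp
  | Seq com com (infixr \<open>;;\<close> 60)
  | If cond com com
  | While cond com

type_synonym store = "var \<Rightarrow> nat"
type_synonym heap = "arr \<Rightarrow> nat \<Rightarrow> nat"

fun aval :: "store \<Rightarrow> heap \<Rightarrow> aexp \<Rightarrow> nat" where
  "aval r h (C c) = c"
| "aval r h (V x) = r x"
| "aval r h (Plus e f) = aval r h e + aval r h f"
| "aval r h (Minus e f) = aval r h e - aval r h f"
| "aval r h (Rd a e) = h a (aval r h e)"

text \<open>Every array has \<open>N\<close> cells, and \<open>L\<close> is the number of machine words.\<close>

fun safe :: "nat \<Rightarrow> nat \<Rightarrow> store \<Rightarrow> heap \<Rightarrow> aexp \<Rightarrow> bool" where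
  "safe N L r h (C c) \<longleftrightarrow> c < L"
| "safe N L r h (V x) \<longleftrightarrow> True"
| "safe N L r h (Plus e f) \<longleftrightarrow> safe N L r h e \<and> safe N L r h f \<and> aval r h e + aval r h f < L"
| "safe N L r h (Minus e f) \<longleftrightarrow> safe N L r h e \<and> safe N L r h f \<and> aval r h f \<le> aval r h e"
| "safe N L r h (Rd a e) \<longleftrightarrow> safe N L r h e \<and> aval r h e < N"

fun bval :: "store \<Rightarrow> heap \<Rightarrow> cond \<Rightarrow> bool" where
  "bval r h (Less e f) \<longleftrightarrow> aval r h e < aval r h f"
| "bval r h (Eq e f) \<longleftrightarrow> aval r h e = aval r h f"

fun bsafe :: "nat \<Rightarrow> nat \<Rightarrow> store \<Rightarrow> heap \<Rightarrow> cond \<Rightarrow> bool" where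
  "bsafe N L r h (Less e f) \<longleftrightarrow> safe N L r h e \<and> safe N L r h f"
| "bsafe N L r h (Eq e f) \<longleftrightarrow> safe N L r h e \<and> safe N L r h f"

text \<open>The number of instructions of the compiled expression, which is also its running time
  because that code is straight-line. The 4 of an array access are three instructions for the
  address and one load.\<close>

fun cost :: "aexp \<Rightarrow> nat" where
  "cost (C c) = 1"
| "cost (V x) = 1"
| "cost (Plus e f) = cost e + cost f + 1"
| "cost (Minus e f) = cost e + cost f + 1"
| "cost (Rd a e) = cost e + 4"

fun bcost :: "cond \<Rightarrow> nat" where
  "bcost (Less e f) = cost e + cost f + 1"
| "bcost (Eq e f) = cost e + cost f + 1"

text \<open>The clock counts machine steps exactly, including the jumps around branches and back to
  loop heads. Unsafe expressions have no rule, so a derivation certifies termination and also that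
  no sum overflows, no difference wraps around and no index leaves its array.\<close>

inductive big_step ::
    "nat \<Rightarrow> nat \<Rightarrow> com \<Rightarrow> store \<Rightarrow> heap \<Rightarrow> nat \<Rightarrow> store \<Rightarrow> heap \<Rightarrow> bool" for N L where
  Skip: "big_step N L Skip r h 0 r h"
| Assign: "safe N L r h e \<Longrightarrow>
    big_step N L (Assign x e) r h (cost e + 1) (r(x := aval r h e)) h"
| Write: "safe N L r h e \<Longrightarrow> safe N L r h f \<Longrightarrow> aval r h e < N \<Longrightarrow>
    big_step N L (Write a e f) r h (cost e + cost f + 4) r (h(a := (h a)(aval r h e := aval r h f)))"
| Seq: "big_step N L c r h t r' h' \<Longrightarrow> big_step N L d r' h' t' r'' h'' \<Longrightarrow>
    big_step N L (c ;; d) r h (t + t') r'' h''"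
| IfTrue: "bsafe N L r h g \<Longrightarrow> bval r h g \<Longrightarrow> big_step N L c r h t r' h' \<Longrightarrow>
    big_step N L (If g c d) r h (bcost g + t) r' h'"
| IfFalse: "bsafe N L r h g \<Longrightarrow> \<not> bval r h g \<Longrightarrow> big_step N L d r h t r' h' \<Longrightarrow>
    big_step N L (If g c d) r h (bcost g + t + 1) r' h'"
| WhileTrue: "bsafe N L r h g \<Longrightarrow> bval r h g \<Longrightarrow> big_step N L c r h t r' h' \<Longrightarrow>
    big_step N L (While g c) r' h' t' r'' h'' \<Longrightarrow>
    big_step N L (While g c) r h (bcost g + t + 1 + t') r'' h''"
| WhileFalse: "bsafe N L r h g \<Longrightarrow> \<not> bval r h g \<Longrightarrow>
    big_step N L (While g c) r h (bcost g + 1) r h"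

inductive_cases big_step_SkipE: "big_step N L Skip r h t r' h'"
inductive_cases big_step_AssignE: "big_step N L (Assign x e) r h t r' h'"
inductive_cases big_step_WriteE: "big_step N L (Write a e f) r h t r' h'"
inductive_cases big_step_SeqE: "big_step N L (c ;; d) r h t r' h'"
inductive_cases big_step_IfE: "big_step N L (If g c d) r h t r' h'"

fun mods :: "com \<Rightarrow> var set" where
  "mods (Assign x e) = {x}"
| "mods (c ;; d) = mods c \<union> mods d"
| "mods (If g c d) = mods c \<union> mods d"
| "mods (While g c) = mods c"
| "mods _ = {}"

fun writes :: "com \<Rightarrow> arr set" where
  "writes (Write a e f) = {a}"
| "writes (c ;; d) = writes c \<union> writes d"
| "writes (If g c d) = writes c \<union> writes d"
| "writes (While g c) = writes c"
| "writes _ = {}"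

text \<open>A syntactic over-approximation of what a command changes; it frees the loop invariants
  from listing everything that stays the same.\<close>

definition frame :: "com \<Rightarrow> store \<Rightarrow> heap \<Rightarrow> store \<Rightarrow> heap \<Rightarrow> bool" where
  "frame c r h r' h' \<longleftrightarrow> (\<forall>x. x \<notin> mods c \<longrightarrow> r' x = r x) \<and> (\<forall>a. a \<notin> writes c \<longrightarrow> h' a = h a)"

lemma frame_refl: "frame c r h r h"
  by (simp add: frame_def)

lemma frame_trans: "frame c r h r' h' \<Longrightarrow> frame c r' h' r'' h'' \<Longrightarrow> frame c r h r'' h''"
  by (simp add: frame_def)

lemma big_step_frame: "big_step N L c r h t r' h' \<Longrightarrow> frame c r h r' h'"
  by (induction rule: big_step.induct) (auto simp: frame_def)

section \<open>Weakest preconditions with a clock\<close>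

text \<open>\<open>t\<close> is the time already spent, so postconditions speak of absolute time and
  sequencing becomes plain nesting, as in \<open>wp_Seq\<close>. The existential quantifier demands
  termination.\<close>

definition wp ::
    "nat \<Rightarrow> nat \<Rightarrow> com \<Rightarrow> (nat \<Rightarrow> store \<Rightarrow> heap \<Rightarrow> bool) \<Rightarrow> nat \<Rightarrow> store \<Rightarrow> heap \<Rightarrow> bool" where
  "wp N L c Q t r h \<longleftrightarrow> (\<exists>t' r' h'. big_step N L c r h t' r' h' \<and> Q (t + t') r' h')"

lemma wp_Skip [simp]: "wp N L Skip Q t r h \<longleftrightarrow> Q t r h"
proof
  assume "Q t r h"
  then have "Q (t + 0) r h" by simp
  then show "wp N L Skip Q t r h" unfolding wp_def by (blast intro: big_step.Skip)
qed (auto simp: wp_def elim: big_step_SkipE)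

lemma wp_Assign [simp]:
  "wp N L (Assign x e) Q t r h \<longleftrightarrow>
     safe N L r h e \<and> Q (t + cost e + 1) (r(x := aval r h e)) h"
  unfolding wp_def by (fastforce elim: big_step_AssignE intro: big_step.Assign simp: algebra_simps)

lemma wp_Write [simp]:
  "wp N L (Write a e f) Q t r h \<longleftrightarrow>
     safe N L r h e \<and> safe N L r h f \<and> aval r h e < N \<and>
     Q (t + cost e + cost f + 4) r (h(a := (h a)(aval r h e := aval r h f)))"
  unfolding wp_def by (fastforce elim: big_step_WriteE intro: big_step.Write simp: algebra_simps)

lemma wp_Seq [simp]: "wp N L (c ;; d) Q = wp N L c (wp N L d Q)"
proof (intro ext iffI)
  fix t r h
  assume "wp N L (c ;; d) Q t r h"
  then show "wp N L c (wp N L d Q) t r h"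
    unfolding wp_def by (fastforce elim: big_step_SeqE simp: add.assoc)
next
  fix t r h
  assume "wp N L c (wp N L d Q) t r h"
  then show "wp N L (c ;; d) Q t r h"
    unfolding wp_def by (metis big_step.Seq add.assoc)
qed

lemma wp_If [simp]:
  "wp N L (If g c d) Q t r h \<longleftrightarrow>
     bsafe N L r h g \<and> (if bval r h g then wp N L c Q (t + bcost g) r h
                        else wp N L d Q (t + bcost g + 1) r h)"
proof
  assume "wp N L (If g c d) Q t r h"
  then show "bsafe N L r h g \<and> (if bval r h g then wp N L c Q (t + bcost g) r h
                        else wp N L d Q (t + bcost g + 1) r h)"
    unfolding wp_def by (fastforce elim: big_step_IfE simp: algebra_simps)
next
  assume *: "bsafe N L r h g \<and> (if bval r h g then wp N L c Q (t + bcost g) r h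
                        else wp N L d Q (t + bcost g + 1) r h)"
  show "wp N L (If g c d) Q t r h"
  proof (cases "bval r h g")
    case True
    with * show ?thesis unfolding wp_def by (metis big_step.IfTrue add.assoc)
  next
    case False
    with * obtain t' r' h' where "big_step N L d r h t' r' h'" "Q (t + bcost g + 1 + t') r' h'"
      unfolding wp_def by auto
    moreover have "t + bcost g + 1 + t' = t + (bcost g + t' + 1)" by simp
    ultimately show ?thesis
      using * False unfolding wp_def by (metis big_step.IfFalse)
  qed
qed

lemma wp_conseq:
  assumes "wp N L c Q t r h"
    and "\<And>t' r' h'. Q t' r' h' \<Longrightarrow> frame c r h r' h' \<Longrightarrow> Q' t' r' h'"
  shows "wp N L c Q' t r h"
  using assms unfolding wp_def by (meson big_step_frame)

text \<open>The number \<open>n\<close> in the invariant is a potential: it pays for all later iterations, and each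
  iteration must release the time that it takes.\<close>

lemma wp_While:
  assumes init: "I n r h"
    and safe: "\<And>n r' h'. I n r' h' \<Longrightarrow> frame c r h r' h' \<Longrightarrow> bsafe N L r' h' g"
    and body: "\<And>n r' h'. I n r' h' \<Longrightarrow> frame c r h r' h' \<Longrightarrow> bval r' h' g \<Longrightarrow>
      wp N L c (\<lambda>t r'' h''. \<exists>n'. I n' r'' h'' \<and> t + n' \<le> n) (bcost g + 1) r' h'"
    and exit: "\<And>n' t' r' h'. I n' r' h' \<Longrightarrow> frame c r h r' h' \<Longrightarrow> \<not> bval r' h' g \<Longrightarrow>
      t' + n' \<le> t + n + bcost g + 1 \<Longrightarrow> Q t' r' h'"
  shows "wp N L (While g c) Q t r h"
proof -
  have "I n r' h' \<Longrightarrow> frame c r h r' h' \<Longrightarrow>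
      \<exists>t' n' r'' h''. big_step N L (While g c) r' h' t' r'' h'' \<and> I n' r'' h'' \<and>
        frame c r h r'' h'' \<and> \<not> bval r'' h'' g \<and> t' + n' \<le> n + bcost g + 1" for n r' h'
  proof (induction n arbitrary: r' h' rule: less_induct)
    case (less n)
    show ?case
    proof (cases "bval r' h' g")
      case False
      have "big_step N L (While g c) r' h' (bcost g + 1) r' h'"
        using safe[OF less.prems] False by (rule big_step.WhileFalse)
      then show ?thesis
        using less.prems False by (intro exI conjI) (assumption+, simp)
    next
      case True
      from body[OF less.prems True] obtain t1 n1 r1 h1 where
        1: "big_step N L c r' h' t1 r1 h1" "I n1 r1 h1" "bcost g + 1 + t1 + n1 \<le> n"
        unfolding wp_def by blast
      have fr: "frame c r h r1 h1"
        using less.prems(2) big_step_frame[OF 1(1)] by (rule frame_trans)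
      \<comment> \<open>The body starts its clock at \<open>bcost g + 1\<close>, so every iteration
        releases a positive amount; the induction on the potential thereby yields termination
        too.\<close>
      have less_n: "n1 < n"
        using 1(3) by simp
      from less.IH[OF less_n 1(2) fr] obtain t2 n2 r2 h2 where
        2: "big_step N L (While g c) r1 h1 t2 r2 h2" "I n2 r2 h2" "frame c r h r2 h2"
          "\<not> bval r2 h2 g" "t2 + n2 \<le> n1 + bcost g + 1"
        by (elim exE conjE)
      have "big_step N L (While g c) r' h' (bcost g + t1 + 1 + t2) r2 h2"
        using safe[OF less.prems] True 1(1) 2(1) by (rule big_step.WhileTrue)
      moreover have "bcost g + t1 + 1 + t2 + n2 \<le> n + bcost g + 1"
        using 1(3) 2(5) by simp
      ultimately show ?thesis
        using 2(2-4) by (intro exI conjI)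
    qed
  qed
  from this[OF init frame_refl] obtain t' n' r' h' where
    *: "big_step N L (While g c) r h t' r' h'" "I n' r' h'" "frame c r h r' h'" "\<not> bval r' h' g"
    "t' + n' \<le> n + bcost g + 1"
    by (elim exE conjE)
  have "Q (t + t') r' h'"
    using *(5) by (intro exit[OF *(2-4)]) simp
  with *(1) show ?thesis
    unfolding wp_def by (intro exI conjI)
qed

section \<open>Compilation to the word RAM\<close>

text \<open>Register 0 holds \<open>N\<close>, registers from 11 on are scratch space, and array \<open>a\<close> starts at
  address \<open>arr_of a * N\<close>; the input, array 0, stays where it is.\<close>

fun reg_of :: "var \<Rightarrow> nat" where
  "reg_of Ans = 1" | "reg_of NumQ = 2" | "reg_of TrEnd = 3" | "reg_of InEnd = 4"
| "reg_of Edge = 5" | "reg_of St = 6" | "reg_of Sp = 7" | "reg_of Pos = 8" | "reg_of Sym = 9"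
| "reg_of Chg = 10"

fun arr_of :: "arr \<Rightarrow> nat" where
  "arr_of Inp = 0" | "arr_of Cur = 1" | "arr_of New = 2" | "arr_of Mark = 3"
| "arr_of Head = 4" | "arr_of Nxt = 5" | "arr_of Stk = 6"

text \<open>The scratch registers form an evaluation stack: the result goes to register
  \<open>d\<close>, and registers below \<open>d\<close> are preserved. The machine has no move
  instruction; \<open>Op Or\<close> with equal operands copies a register.\<close>

fun compile_exp :: "aexp \<Rightarrow> nat \<Rightarrow> instr list" where
  "compile_exp (C c) d = [Const d c]"
| "compile_exp (V x) d = [Op Or d (reg_of x) (reg_of x)]"
| "compile_exp (Plus e f) d = compile_exp e d @ compile_exp f (Suc d) @ [Op Add d d (Suc d)]"
| "compile_exp (Minus e f) d = compile_exp e d @ compile_exp f (Suc d) @ [Op Sub d d (Suc d)]"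
| "compile_exp (Rd a e) d =
     compile_exp e d @ [Const (Suc d) (arr_of a), Op Mul (Suc d) (Suc d) 0, Op Add d d (Suc d), Load d d]"

fun compile_cond :: "cond \<Rightarrow> nat \<Rightarrow> instr list" where
  "compile_cond (Less e f) l = compile_exp e 11 @ compile_exp f 12 @ [JumpLess 11 12 l]"
| "compile_cond (Eq e f) l = compile_exp e 11 @ compile_exp f 12 @ [JumpEq 11 12 l]"

fun com_len :: "com \<Rightarrow> nat" where
  "com_len Skip = 0"
| "com_len (Assign x e) = cost e + 1"
| "com_len (Write a e f) = cost e + cost f + 4"
| "com_len (c ;; d) = com_len c + com_len d"
| "com_len (If g c d) = bcost g + com_len d + 1 + com_len c"
| "com_len (While g c) = bcost g + 1 + com_len c + 1"

text \<open>Jump targets are absolute, hence the parameter \<open>i\<close> for the address of the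
  first instruction; \<open>com_len\<close> does not depend on it, which makes forward targets
  computable. The else branch comes first because the conditional jumps are taken when the test
  succeeds.\<close>

fun compile :: "nat \<Rightarrow> com \<Rightarrow> instr list" where
  "compile i Skip = []"
| "compile i (Assign x e) = compile_exp e 11 @ [Op Or (reg_of x) 11 11]"
| "compile i (Write a e f) =
     compile_exp e 11 @ [Const 12 (arr_of a), Op Mul 12 12 0, Op Add 11 11 12] @
     compile_exp f 12 @ [Store 11 12]"
| "compile i (c ;; d) = compile i c @ compile (i + com_len c) d"
| "compile i (If g c d) =
     (let j = i + bcost g; k = j + com_len d + 1
      in compile_cond g k @ compile j d @ [Jump (k + com_len c)] @ compile k c)"
| "compile i (While g c) =
     (let j = i + bcost g + 1
      in compile_cond g j @ [Jump (j + com_len c + 1)] @ compile j c @ [Jump i])"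

lemma length_compile_exp [simp]: "length (compile_exp e d) = cost e"
  by (induction e arbitrary: d) auto

lemma length_compile_cond [simp]: "length (compile_cond g l) = bcost g"
  by (cases g) auto

lemma length_compile [simp]: "length (compile i c) = com_len c"
  by (induction c arbitrary: i) (auto simp: Let_def)

section \<open>Simulation of the language by compiled code\<close>

fun straight :: "instr \<Rightarrow> bool" where
  "straight (Jump l) \<longleftrightarrow> False"
| "straight (JumpEq i j l) \<longleftrightarrow> False"
| "straight (JumpLess i j l) \<longleftrightarrow> False"
| "straight _ \<longleftrightarrow> True"

lemma pc_exec_straight: "straight ins \<Longrightarrow> pc (exec b ins s) = Suc (pc s)"
  by (cases ins) auto

lemma pc_fold_straight: "list_all straight cs \<Longrightarrow> pc (fold (exec b) cs s) = pc s + length cs"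
  by (induction cs arbitrary: s) (auto simp: pc_exec_straight)

lemma step_nth: "P = xs @ ins # ys \<Longrightarrow> pc s = length xs \<Longrightarrow> step b P s = exec b ins s"
  by (simp add: step_def halted_def)

lemma steps_straight:
  "P = xs @ cs @ ys \<Longrightarrow> pc s = length xs \<Longrightarrow> list_all straight cs \<Longrightarrow>
     (step b P ^^ length cs) s = fold (exec b) cs s"
proof (induction cs arbitrary: xs s)
  case (Cons ins cs)
  have "step b P s = exec b ins s"
    using Cons.prems by (intro step_nth[of _ xs _ "cs @ ys"]) auto
  moreover have "(step b P ^^ length cs) (exec b ins s) = fold (exec b) cs (exec b ins s)"
    using Cons.prems by (intro Cons.IH[of "xs @ [ins]"]) (auto simp: pc_exec_straight)
  ultimately show ?case by (simp add: funpow_swap1)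
qed simp

lemma steps_add:
  "(step b P ^^ t) s = s' \<Longrightarrow> (step b P ^^ t') s' = s'' \<Longrightarrow> (step b P ^^ (t + t')) s = s''"
  by (metis add.commute comp_apply funpow_add)

lemma straight_compile_exp: "list_all straight (compile_exp e d)"
  by (induction e arbitrary: d) auto

lemma reg_of_less: "reg_of x < 11"
  by (cases x) auto

lemma reg_of_pos: "0 < reg_of x"
  by (cases x) auto

lemma reg_of_inject [simp]: "reg_of x = reg_of y \<longleftrightarrow> x = y"
  by (cases x; cases y) auto

lemma arr_of_le: "arr_of a \<le> 6"
  by (cases a) auto

lemma arr_of_inject [simp]: "arr_of a = arr_of a' \<longleftrightarrow> a = a'"
  by (cases a; cases a') auto

text \<open>Division by \<open>N\<close> recovers the array from an address, so a write to one cell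
  leaves all other cells and arrays alone.\<close>

lemma address_inject:
  assumes "i < N" "j < N"
  shows "arr_of a * N + i = arr_of a' * N + j \<longleftrightarrow> a = a' \<and> i = j"
proof
  assume *: "arr_of a * N + i = arr_of a' * N + j"
  have "(arr_of a * N + i) div N = arr_of a" "(arr_of a' * N + j) div N = arr_of a'"
    using assms by auto
  with * have "arr_of a = arr_of a'" by metis
  with * show "a = a' \<and> i = j" by simp
qed simp

text \<open>The bound \<open>7 * N \<le> 2 ^ b\<close> makes all seven arrays addressable. Scratch
  registers are left open, so evaluating an expression preserves the relation.\<close>

definition represents :: "nat \<Rightarrow> nat \<Rightarrow> store \<Rightarrow> heap \<Rightarrow> config \<Rightarrow> bool" where
  "represents N b r h s \<longleftrightarrow> 0 < N \<and> 7 * N \<le> 2 ^ b \<and> reg s 0 = N \<and>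
     (\<forall>x. reg s (reg_of x) = r x \<and> r x < 2 ^ b) \<and>
     (\<forall>a. \<forall>i<N. mem s (arr_of a * N + i) = h a i \<and> h a i < 2 ^ b)"

lemma represents_mono:
  "represents N b r h s \<Longrightarrow> (\<forall>x<11. reg s' x = reg s x) \<Longrightarrow> mem s' = mem s \<Longrightarrow>
     represents N b r h s'"
  unfolding represents_def using reg_of_less by auto

lemma address_less:
  assumes "represents N b r h s" "i < N"
  shows "arr_of a * N + i < 2 ^ b" "arr_of a * N < 2 ^ b" "arr_of a < 2 ^ b"
proof -
  have N: "0 < N" "7 * N \<le> 2 ^ b" using assms by (auto simp: represents_def)
  have "arr_of a * N \<le> 6 * N" using arr_of_le by (rule mult_right_mono) simp
  then show "arr_of a * N + i < 2 ^ b" using N assms(2) by linarith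
  then show "arr_of a * N < 2 ^ b" by linarith
  moreover have "arr_of a * 1 \<le> arr_of a * N" using N by (intro mult_left_mono) auto
  ultimately show "arr_of a < 2 ^ b" by linarith
qed

lemma compile_exp_correct:
  assumes "represents N b r h s" "safe N (2 ^ b) r h e" "10 < d"
  shows "reg (fold (exec b) (compile_exp e d) s) d = aval r h e \<and>
    aval r h e < 2 ^ b \<and>
    (\<forall>x<d. reg (fold (exec b) (compile_exp e d) s) x = reg s x) \<and>
    mem (fold (exec b) (compile_exp e d) s) = mem s"
  using assms
proof (induction e arbitrary: d s)
  case (C c)
  then show ?case by simp
next
  case (V x)
  then show ?case by (simp add: represents_def)
next
  case (Plus e f)
  let ?s = "fold (exec b) (compile_exp e d) s"
  have e: "reg ?s d = aval r h e" "\<forall>x<d. reg ?s x = reg s x" "mem ?s = mem s"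
    using Plus.IH(1)[of s d] Plus.prems by auto
  have "represents N b r h ?s"
    using Plus.prems(1) by (rule represents_mono) (use e Plus.prems(3) in auto)
  from Plus.IH(2)[OF this, of "Suc d"] Plus.prems e show ?case by simp
next
  case (Minus e f)
  let ?s = "fold (exec b) (compile_exp e d) s"
  have e: "reg ?s d = aval r h e" "\<forall>x<d. reg ?s x = reg s x" "mem ?s = mem s" "aval r h e < 2 ^ b"
    using Minus.IH(1)[of s d] Minus.prems by auto
  have "represents N b r h ?s"
    using Minus.prems(1) by (rule represents_mono) (use e Minus.prems(3) in auto)
  note f = Minus.IH(2)[OF this, of "Suc d"]
  \<comment> \<open>The machine adds \<open>2 ^ b\<close> before it subtracts; a safe difference is
    nonnegative, so the reduction modulo \<open>2 ^ b\<close> removes exactly this summand.\<close>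
  have le: "aval r h f \<le> aval r h e" using Minus.prems(2) by simp
  then have "aval r h e + 2 ^ b - aval r h f = aval r h e - aval r h f + 2 ^ b" by simp
  moreover have less: "aval r h e - aval r h f < 2 ^ b" using e(4) by (rule less_imp_diff_less)
  ultimately have "(aval r h e + 2 ^ b - aval r h f) mod 2 ^ b = aval r h e - aval r h f"
    by (metis mod_add_self2 mod_less)
  then show ?case using f less Minus.prems(2,3) e(1-3) by simp
next
  case (Rd a e)
  let ?s = "fold (exec b) (compile_exp e d) s"
  have e: "reg ?s d = aval r h e" "\<forall>x<d. reg ?s x = reg s x" "mem ?s = mem s" "aval r h e < N"
    using Rd.IH[of s d] Rd.prems by auto
  have "reg ?s 0 = N" using e(2) Rd.prems(1,3) by (auto simp: represents_def)
  moreover have "mem s (aval r h e + arr_of a * N) = h a (aval r h e)" "h a (aval r h e) < 2 ^ b"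
    using Rd.prems(1) e(4) by (auto simp: represents_def add.commute)
  ultimately show ?case
    using e address_less[OF Rd.prems(1) e(4), of a] Rd.prems(3) by (simp add: add.commute)
qed

lemma steps_compile_exp:
  assumes "P = xs @ compile_exp e d @ ys" "pc s = length xs"
    and "represents N b r h s" "safe N (2 ^ b) r h e" "10 < d"
  obtains s' where "(step b P ^^ cost e) s = s'" "pc s' = length xs + cost e"
    "reg s' d = aval r h e" "aval r h e < 2 ^ b" "\<forall>x<d. reg s' x = reg s x" "mem s' = mem s"
    "represents N b r h s'"
proof
  let ?s = "fold (exec b) (compile_exp e d) s"
  show "(step b P ^^ cost e) s = ?s"
    using steps_straight[OF assms(1,2) straight_compile_exp] by simp
  show "pc ?s = length xs + cost e"
    using assms(2) by (simp add: pc_fold_straight straight_compile_exp)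
  show *: "reg ?s d = aval r h e" "aval r h e < 2 ^ b" "\<forall>x<d. reg ?s x = reg s x" "mem ?s = mem s"
    using compile_exp_correct[OF assms(3-5)] by blast+
  show "represents N b r h ?s"
    using assms(3) by (rule represents_mono) (use * assms(5) in auto)
qed

lemma steps_compile_cond:
  assumes "P = xs @ compile_cond g l @ ys" "pc s = length xs"
    and "represents N b r h s" "bsafe N (2 ^ b) r h g"
  obtains s' where "(step b P ^^ bcost g) s = s'"
    "pc s' = (if bval r h g then l else length xs + bcost g)" "represents N b r h s'"
proof -
  \<comment> \<open>The two kinds of condition differ only in the final jump; with
    \<open>jmp\<close> in its place both are treated at once.\<close>
  obtain e f jmp where g: "compile_cond g l = compile_exp e 11 @ compile_exp f 12 @ [jmp]"
    and bc: "bcost g = cost e + (cost f + 1)"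
    and sf: "safe N (2 ^ b) r h e" "safe N (2 ^ b) r h f"
    and jmp: "\<And>s. reg s 11 = aval r h e \<Longrightarrow> reg s 12 = aval r h f \<Longrightarrow>
      exec b jmp s = s\<lparr>pc := (if bval r h g then l else pc s + 1)\<rparr>"
    using assms(4) by (cases g) auto
  have P: "P = xs @ compile_exp e 11 @ (compile_exp f 12 @ jmp # ys)"
    and P': "P = (xs @ compile_exp e 11) @ compile_exp f 12 @ (jmp # ys)"
    using assms(1) g by simp_all
  obtain s1 where s1: "(step b P ^^ cost e) s = s1" "pc s1 = length xs + cost e"
    "reg s1 11 = aval r h e" "aval r h e < 2 ^ b" "\<forall>x<11. reg s1 x = reg s x" "mem s1 = mem s"
    "represents N b r h s1"
    by (rule steps_compile_exp[OF P assms(2,3) sf(1)]) simp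
  have pc1: "pc s1 = length (xs @ compile_exp e 11)" using s1 by simp
  obtain s2 where s2: "(step b P ^^ cost f) s1 = s2" "pc s2 = length (xs @ compile_exp e 11) + cost f"
    "reg s2 12 = aval r h f" "aval r h f < 2 ^ b" "\<forall>x<12. reg s2 x = reg s1 x" "mem s2 = mem s1"
    "represents N b r h s2"
    by (rule steps_compile_exp[OF P' pc1 s1(7) sf(2)]) simp
  have "step b P s2 = exec b jmp s2"
    by (rule step_nth[of _ "xs @ compile_exp e 11 @ compile_exp f 12" _ ys])
      (use assms(1) g s2 in auto)
  also have "\<dots> = s2\<lparr>pc := (if bval r h g then l else pc s2 + 1)\<rparr>"
    using s1 s2 by (intro jmp) auto
  finally have s3: "(step b P ^^ 1) s2 = s2\<lparr>pc := (if bval r h g then l else pc s2 + 1)\<rparr>"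
    by simp
  show thesis
  proof (rule that)
    show "(step b P ^^ bcost g) s = s2\<lparr>pc := (if bval r h g then l else pc s2 + 1)\<rparr>"
      unfolding bc by (intro steps_add[OF s1(1)] steps_add[OF s2(1)] s3)
    show "represents N b r h (s2\<lparr>pc := (if bval r h g then l else pc s2 + 1)\<rparr>)"
      using s2(7) by (rule represents_mono) auto
  qed (use s2(2) bc in auto)
qed

lemma steps_jump:
  assumes "P = xs @ Jump l # ys" "pc s = length xs" "represents N b r h s"
  shows "(step b P ^^ 1) s = s\<lparr>pc := l\<rparr>" "represents N b r h (s\<lparr>pc := l\<rparr>)"
  using step_nth[OF assms(1,2), of b] represents_mono[OF assms(3), of "s\<lparr>pc := l\<rparr>"] by auto

text \<open>The number of steps is exactly \<open>t\<close>, so time bounds carry over to the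
  machine. The context \<open>xs\<close>, \<open>ys\<close> is general because the induction moves
  to subcommands in the middle of the program, while another round of a loop returns to the same
  \<open>xs\<close>.\<close>

theorem compile_correct:
  assumes "big_step N (2 ^ b) c r h t r' h'"
    and "P = xs @ compile (length xs) c @ ys" "pc s = length xs" "represents N b r h s"
  shows "\<exists>s'. (step b P ^^ t) s = s' \<and> pc s' = length xs + com_len c \<and> represents N b r' h' s'"
  using assms
proof (induction arbitrary: xs ys s rule: big_step.induct)
  case (Skip r h)
  then show ?case by simp
next
  case (Assign r h e x)
  have P: "P = xs @ compile_exp e 11 @ (Op Or (reg_of x) 11 11 # ys)"
    using Assign.prems by simp
  obtain s1 where s1: "(step b P ^^ cost e) s = s1" "pc s1 = length xs + cost e"
    "reg s1 11 = aval r h e" "aval r h e < 2 ^ b" "\<forall>x<11. reg s1 x = reg s x" "mem s1 = mem s"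
    "represents N b r h s1"
    by (rule steps_compile_exp[OF P Assign.prems(2,3) Assign.hyps]) simp
  let ?s = "exec b (Op Or (reg_of x) 11 11) s1"
  have "step b P s1 = ?s"
    by (rule step_nth[of _ "xs @ compile_exp e 11" _ ys]) (use P s1 in simp_all)
  then have s2: "(step b P ^^ (cost e + 1)) s = ?s"
    by (intro steps_add[OF s1(1)]) simp
  have "represents N b (r(x := aval r h e)) h ?s"
    using s1(3,4,7) reg_of_pos[of x] by (auto simp: represents_def)
  moreover have "pc ?s = length xs + com_len (Assign x e)" using s1(2) by simp
  ultimately show ?case using s2 by (intro exI conjI)
next
  case (Write r h e f a)
  let ?cs = "[Const 12 (arr_of a), Op Mul 12 12 0, Op Add 11 11 12]"
  let ?xs1 = "xs @ compile_exp e 11" and ?xs2 = "xs @ compile_exp e 11 @ ?cs"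
  have P: "P = xs @ compile_exp e 11 @ (?cs @ compile_exp f 12 @ Store 11 12 # ys)"
    and P1: "P = ?xs1 @ ?cs @ (compile_exp f 12 @ Store 11 12 # ys)"
    and P2: "P = ?xs2 @ compile_exp f 12 @ (Store 11 12 # ys)"
    and P3: "P = (?xs2 @ compile_exp f 12) @ Store 11 12 # ys"
    using Write.prems by simp_all
  obtain s1 where s1: "(step b P ^^ cost e) s = s1" "pc s1 = length xs + cost e"
    "reg s1 11 = aval r h e" "aval r h e < 2 ^ b" "\<forall>x<11. reg s1 x = reg s x" "mem s1 = mem s"
    "represents N b r h s1"
    by (rule steps_compile_exp[OF P Write.prems(2,3) Write.hyps(1)]) simp
  define s2 where "s2 = fold (exec b) ?cs s1"
  have pc1: "pc s1 = length ?xs1" using s1(2) by simp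
  have s2: "(step b P ^^ length ?cs) s1 = s2"
    unfolding s2_def by (rule steps_straight[OF P1 pc1]) simp
  have "reg s1 0 = N" using s1(7) by (simp add: represents_def)
  then have r2: "reg s2 11 = arr_of a * N + aval r h e"
    using s1(3) address_less[OF s1(7) Write.hyps(3), of a] by (simp add: s2_def add.commute)
  have rep2: "represents N b r h s2"
    using s1(7) by (rule represents_mono) (simp_all add: s2_def)
  have pc2: "pc s2 = length ?xs2"
    using s1(2) by (simp add: s2_def)
  obtain s3 where s3: "(step b P ^^ cost f) s2 = s3" "pc s3 = length ?xs2 + cost f"
    "reg s3 12 = aval r h f" "aval r h f < 2 ^ b" "\<forall>x<12. reg s3 x = reg s2 x" "mem s3 = mem s2"
    "represents N b r h s3"
    by (rule steps_compile_exp[OF P2 pc2 rep2 Write.hyps(2)]) simp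
  have "step b P s3 = exec b (Store 11 12) s3"
    by (rule step_nth[OF P3]) (use s3(2) in simp)
  then have s4: "(step b P ^^ 1) s3 = exec b (Store 11 12) s3" by simp
  have "(step b P ^^ (cost e + (length ?cs + (cost f + 1)))) s = exec b (Store 11 12) s3"
    by (intro steps_add[OF s1(1)] steps_add[OF s2] steps_add[OF s3(1)] s4)
  moreover have "cost e + (length ?cs + (cost f + 1)) = cost e + cost f + 4" by simp
  ultimately have s5: "(step b P ^^ (cost e + cost f + 4)) s = exec b (Store 11 12) s3"
    by metis
  have "reg s3 11 = arr_of a * N + aval r h e" using s3(5) r2 by simp
  then have "represents N b r (h(a := (h a)(aval r h e := aval r h f))) (exec b (Store 11 12) s3)"
    using s3(3,4,7) Write.hyps(3) by (auto simp: represents_def address_inject)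
  moreover have "pc (exec b (Store 11 12) s3) = length xs + com_len (Write a e f)"
    using s3(2) by simp
  ultimately show ?case using s5 by (intro exI conjI)
next
  case (Seq c r h t r' h' d t' r'' h'')
  have P: "P = xs @ compile (length xs) c @ (compile (length xs + com_len c) d @ ys)"
    and P1: "P = (xs @ compile (length xs) c) @ compile (length (xs @ compile (length xs) c)) d @ ys"
    using Seq.prems by simp_all
  obtain s1 where s1: "(step b P ^^ t) s = s1" "pc s1 = length xs + com_len c"
      "represents N b r' h' s1"
    using Seq.IH(1)[OF P Seq.prems(2,3)] by blast
  have "pc s1 = length (xs @ compile (length xs) c)" using s1(2) by simp
  from Seq.IH(2)[OF P1 this s1(3)] obtain s2 where
    s2: "(step b P ^^ t') s1 = s2" "pc s2 = length (xs @ compile (length xs) c) + com_len d"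
      "represents N b r'' h'' s2"
    by blast
  show ?case using steps_add[OF s1(1) s2(1)] s2(2,3) by simp
next
  case (IfTrue r h g c t r' h' d)
  let ?k = "length xs + bcost g + com_len d + 1"
  let ?xs1 = "xs @ compile_cond g ?k @ compile (length xs + bcost g) d @ [Jump (?k + com_len c)]"
  have P: "P = xs @ compile_cond g ?k @ (compile (length xs + bcost g) d @
      Jump (?k + com_len c) # compile ?k c @ ys)"
    and P1: "P = ?xs1 @ compile (length ?xs1) c @ ys"
    using IfTrue.prems by (simp_all add: Let_def add.assoc)
  obtain s1 where s1: "(step b P ^^ bcost g) s = s1"
    "pc s1 = (if bval r h g then ?k else length xs + bcost g)" "represents N b r h s1"
    by (rule steps_compile_cond[OF P IfTrue.prems(2,3) IfTrue.hyps(1)])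
  have pc1: "pc s1 = length ?xs1" using s1(2) IfTrue.hyps by simp
  obtain s2 where s2: "(step b P ^^ t) s1 = s2" "pc s2 = length ?xs1 + com_len c"
      "represents N b r' h' s2"
    using IfTrue.IH[OF P1 pc1 s1(3)] by blast
  show ?case using steps_add[OF s1(1) s2(1)] s2(2,3) by simp
next
  case (IfFalse r h g d t r' h' c)
  let ?k = "length xs + bcost g + com_len d + 1"
  let ?xs1 = "xs @ compile_cond g ?k"
  let ?xs2 = "?xs1 @ compile (length ?xs1) d"
  have P: "P = xs @ compile_cond g ?k @ (compile (length xs + bcost g) d @
      Jump (?k + com_len c) # compile ?k c @ ys)"
    and P1: "P = ?xs1 @ compile (length ?xs1) d @ (Jump (?k + com_len c) # compile ?k c @ ys)"
    and P2: "P = ?xs2 @ Jump (?k + com_len c) # (compile ?k c @ ys)"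
    using IfFalse.prems by (simp_all add: Let_def add.assoc)
  obtain s1 where s1: "(step b P ^^ bcost g) s = s1"
    "pc s1 = (if bval r h g then ?k else length xs + bcost g)" "represents N b r h s1"
    by (rule steps_compile_cond[OF P IfFalse.prems(2,3) IfFalse.hyps(1)])
  have pc1: "pc s1 = length ?xs1" using s1(2) IfFalse.hyps by simp
  obtain s2 where s2: "(step b P ^^ t) s1 = s2" "pc s2 = length ?xs1 + com_len d"
      "represents N b r' h' s2"
    using IfFalse.IH[OF P1 pc1 s1(3)] by blast
  have pc2: "pc s2 = length ?xs2" using s2(2) by simp
  note s3 = steps_jump[OF P2 pc2 s2(3)]
  show ?case using steps_add[OF steps_add[OF s1(1) s2(1)] s3(1)] s3(2) by simp
next
  case (WhileTrue r h g c t r' h' t' r'' h'')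
  let ?j = "length xs + bcost g + 1"
  let ?j1 = "Jump (?j + com_len c + 1)" and ?j2 = "Jump (length xs)"
  let ?xs1 = "xs @ compile_cond g ?j @ [?j1]"
  let ?xs2 = "?xs1 @ compile (length ?xs1) c"
  have P: "P = xs @ compile_cond g ?j @ (?j1 # compile ?j c @ ?j2 # ys)"
    and P1: "P = ?xs1 @ compile (length ?xs1) c @ (?j2 # ys)"
    and P2: "P = ?xs2 @ ?j2 # ys"
    using WhileTrue.prems(1) by (simp_all add: Let_def add.assoc)
  obtain s1 where s1: "(step b P ^^ bcost g) s = s1"
    "pc s1 = (if bval r h g then ?j else length xs + bcost g)" "represents N b r h s1"
    by (rule steps_compile_cond[OF P WhileTrue.prems(2,3) WhileTrue.hyps(1)])
  have pc1: "pc s1 = length ?xs1" using s1(2) WhileTrue.hyps by simp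
  obtain s2 where s2: "(step b P ^^ t) s1 = s2" "pc s2 = length ?xs1 + com_len c"
      "represents N b r' h' s2"
    using WhileTrue.IH(1)[OF P1 pc1 s1(3)] by blast
  have pc2: "pc s2 = length ?xs2" using s2(2) by simp
  note s3 = steps_jump[OF P2 pc2 s2(3)]
  have "pc (s2\<lparr>pc := length xs\<rparr>) = length xs" by simp
  from WhileTrue.IH(2)[OF WhileTrue.prems(1) this s3(2)] obtain s4 where
    s4: "(step b P ^^ t') (s2\<lparr>pc := length xs\<rparr>) = s4"
      "pc s4 = length xs + com_len (While g c)" "represents N b r'' h'' s4"
    by blast
  have "(step b P ^^ (bcost g + t + 1 + t')) s = s4"
    by (rule steps_add[OF steps_add[OF steps_add[OF s1(1) s2(1)] s3(1)] s4(1)])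
  with s4 show ?case by (intro exI conjI)
next
  case (WhileFalse r h g c)
  let ?j = "length xs + bcost g + 1"
  let ?j1 = "Jump (?j + com_len c + 1)" and ?j2 = "Jump (length xs)"
  let ?xs1 = "xs @ compile_cond g ?j"
  have P: "P = xs @ compile_cond g ?j @ (?j1 # compile ?j c @ ?j2 # ys)"
    and P1: "P = ?xs1 @ ?j1 # (compile ?j c @ ?j2 # ys)"
    using WhileFalse.prems(1) by (simp_all add: Let_def add.assoc)
  obtain s1 where s1: "(step b P ^^ bcost g) s = s1"
    "pc s1 = (if bval r h g then ?j else length xs + bcost g)" "represents N b r h s1"
    by (rule steps_compile_cond[OF P WhileFalse.prems(2,3) WhileFalse.hyps(1)])
  have pc1: "pc s1 = length ?xs1" using s1(2) WhileFalse.hyps by simp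
  note s3 = steps_jump[OF P1 pc1 s1(3)]
  show ?case using steps_add[OF s1(1) s3(1)] s3(2) by simp
qed

text \<open>Cells 2 and 3 of the input hold the number \<open>m\<close> of transitions and the length \<open>l\<close> of the string,
  so the input has \<open>N = 6 + 3 * m + l\<close> cells.\<close>

definition prologue :: "instr list" where
  "prologue = [Const 1 2, Load 1 1, Const 2 3, Load 2 2,
     Op Add 2 2 1, Op Add 2 2 1, Op Add 2 2 1, Const 1 6, Op Add 0 2 1]"

definition compile_program :: "com \<Rightarrow> program" where
  "compile_program c = prologue @ compile (length prologue) c @ [Op Or 0 1 1]"

definition input_heap :: "nat list \<Rightarrow> heap" where
  "input_heap xs a i = (case a of Inp \<Rightarrow> if i < length xs then xs ! i else 0 | _ \<Rightarrow> 0)"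

text \<open>The initial store is arbitrary because the prologue leaves intermediate values in the
  registers of \<open>Ans\<close> and \<open>NumQ\<close>; the heap is known since memory beyond the
  input starts at 0. The 10 steps outside the command are nine of the prologue and the final copy of
  \<open>Ans\<close> to register 0.\<close>

lemma answers_within_compile_program:
  assumes len: "length xs = 6 + 3 * xs ! 2 + xs ! 3"
    and small: "7 * length xs \<le> 2 ^ b" "\<And>i. i < length xs \<Longrightarrow> xs ! i < 2 ^ b"
    and wp: "\<And>r. wp (length xs) (2 ^ b) c
        (\<lambda>t r' h'. t + 10 \<le> T \<and> r' Ans = of_bool ans) 0 r (input_heap xs)"
  shows "answers_within b (compile_program c) xs T ans"
proof -
  let ?P = "compile_program c" and ?N = "length xs"
  let ?s1 = "fold (exec b) prologue (initial xs)"
  define r where "r = reg ?s1 \<circ> reg_of"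
  have N: "6 \<le> ?N" using len by simp
  have straight: "list_all straight prologue" by (simp add: prologue_def)
  have s1: "(step b ?P ^^ length prologue) (initial xs) = ?s1"
    by (rule steps_straight[of _ "[]", OF _ _ straight])
      (simp_all add: compile_program_def initial_def)
  have pc1: "pc ?s1 = length prologue"
    by (simp add: pc_fold_straight straight initial_def)
  have small_const: "2 < (2::nat) ^ b" "3 < (2::nat) ^ b" "6 < (2::nat) ^ b"
    using small(1) N by linarith+
  have "2 < ?N" "3 < ?N" using N by simp_all
  then have x: "mem (initial xs) 2 = xs ! 2" "mem (initial xs) 3 = xs ! 3" "xs ! 2 < 2 ^ b" "xs ! 3 < 2 ^ b"
    using small(2) by (simp_all add: initial_def)
  have sum: "xs ! 3 + xs ! 2 + xs ! 2 + xs ! 2 + 6 = ?N" "?N < 2 ^ b"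
    using len small(1) N by linarith+
  define R M where "R = reg (initial xs)" and "M = mem (initial xs)"
  have init: "initial xs = \<lparr>pc = 0, reg = R, mem = M\<rparr>"
    by (simp add: R_def M_def initial_def)
  have "M 2 = xs ! 2" "M 3 = xs ! 3" using x by (simp_all add: M_def)
  then have "?s1 = \<lparr>pc = 9, reg = R(1 := 6, 2 := xs ! 3 + xs ! 2 + xs ! 2 + xs ! 2, 0 := ?N), mem = M\<rparr>"
    using sum small_const x(3,4) unfolding init by (simp add: prologue_def fun_upd_twist)
  then have reg1: "reg ?s1 = R(1 := 6, 2 := xs ! 3 + xs ! 2 + xs ! 2 + xs ! 2, 0 := ?N)"
    and mem1: "mem ?s1 = mem (initial xs)"
    by (simp_all add: M_def)
  have less1: "reg ?s1 y < 2 ^ b" for y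
    using sum small_const unfolding reg1 by (simp add: R_def initial_def)
  have "mem (initial xs) (arr_of a * ?N + i) = input_heap xs a i \<and> input_heap xs a i < 2 ^ b"
    if "i < ?N" for a i
    using that small(2)[of i] by (cases a) (auto simp: initial_def input_heap_def)
  then have "represents ?N b r (input_heap xs) ?s1"
    using N small(1) reg1 less1 by (auto simp: represents_def r_def mem1)
  moreover obtain t r' h' where bs: "big_step ?N (2 ^ b) c r (input_heap xs) t r' h'"
      "t + 10 \<le> T" "r' Ans = of_bool ans"
    using wp[of r] unfolding wp_def by auto
  ultimately obtain s2 where s2: "(step b ?P ^^ t) ?s1 = s2"
      "pc s2 = length prologue + com_len c" "represents ?N b r' h' s2"
    using compile_correct[OF bs(1) _ pc1, of ?P "[Op Or 0 1 1]"]
    unfolding compile_program_def by blast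
  let ?s3 = "exec b (Op Or 0 1 1) s2"
  have "step b ?P s2 = ?s3"
    by (rule step_nth[of _ "prologue @ compile (length prologue) c" _ "[]"])
      (use s2 in \<open>auto simp: compile_program_def\<close>)
  then have s3: "(step b ?P ^^ 1) s2 = ?s3" by simp
  have "(step b ?P ^^ (length prologue + t + 1)) (initial xs) = ?s3"
    by (intro steps_add[OF steps_add[OF s1 s2(1)] s3])
  moreover from s2(3) have "reg s2 (reg_of Ans) = r' Ans \<and> r' Ans < 2 ^ b"
    unfolding represents_def by blast
  then have "reg ?s3 0 = of_bool ans" "halted ?P ?s3"
    using bs(3) s2(2) by (auto simp: halted_def compile_program_def)
  moreover have "length prologue + t + 1 \<le> T" using bs(2) by (simp add: prologue_def)
  ultimately show ?thesis
    unfolding answers_within_def Let_def by (metis of_bool_def)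
qed

section \<open>Sets of reachable states\<close>

definition succs :: "('q, 'a) enfa \<Rightarrow> 'a \<Rightarrow> 'q set \<Rightarrow> 'q set" where
  "succs A a S = {q. \<exists>p\<in>S. (p, Some a, q) \<in> trans A}"

text \<open>With \<open>sub\<close> the closure follows the empty transitions, for subsequences; without it, all
  transitions, for supersequences.\<close>

definition closing :: "bool \<Rightarrow> ('q, 'a) enfa \<Rightarrow> ('q \<times> 'q) set" where
  "closing sub A = {(p, q). \<exists>x. (p, x, q) \<in> trans A \<and> (sub \<longrightarrow> x = None)}"

text \<open>For subsequences the letter may be dropped, so \<open>S\<close> is kept. For
  supersequences it must be read: symbols inserted before it are accounted for by \<open>S\<close>,
  which is closed already, and those after it by the new closure.\<close>

definition next_set :: "bool \<Rightarrow> ('q, 'a) enfa \<Rightarrow> 'a \<Rightarrow> 'q set \<Rightarrow> 'q set" where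
  "next_set sub A a S = (closing sub A)\<^sup>* `` ((if sub then S else {}) \<union> succs A a S)"

definition reach_set :: "bool \<Rightarrow> ('q, 'a) enfa \<Rightarrow> 'a list \<Rightarrow> 'q set" where
  "reach_set sub A w = fold (next_set sub A) w ((closing sub A)\<^sup>* `` {init A})"

lemma reach_set_Nil [simp]: "reach_set sub A [] = (closing sub A)\<^sup>* `` {init A}"
  by (simp add: reach_set_def)

lemma reach_set_snoc [simp]: "reach_set sub A (w @ [a]) = next_set sub A a (reach_set sub A w)"
  by (simp add: reach_set_def)

section \<open>Paths, subsequences and the meaning of the reachable sets\<close>

lemma path_append: "path A p u q \<Longrightarrow> path A q v r \<Longrightarrow> path A p (u @ v) r"
  by (induction rule: path.induct) (auto intro: path.intros)

lemma path_appendE: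
  assumes "path A p (u @ v) r"
  obtains q where "path A p u q" "path A q v r"
proof -
  have "path A p w r \<Longrightarrow> w = u @ v \<Longrightarrow> \<exists>q. path A p u q \<and> path A q v r" for w
  proof (induction arbitrary: u rule: path.induct)
    case (Nil q)
    then show ?case by (auto intro: path.Nil)
  next
    case (Eps p q w r)
    from Eps.IH[OF Eps.prems] Eps.hyps(1) show ?case by (blast intro: path.Eps)
  next
    case (Sym p a q w r)
    show ?case
    proof (cases u)
      case Nil
      with Sym.prems path.Sym[OF Sym.hyps] show ?thesis by (auto intro: path.Nil)
    next
      case (Cons a' u')
      with Sym.prems have "w = u' @ v" "a = a'" by simp_all
      from Sym.IH[OF this(1)] Sym.hyps(1) this(2) Cons show ?thesis by (blast intro: path.Sym)
    qed
  qed
  with assms that show ?thesis by blast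
qed

lemma path_ConsE:
  assumes "path A p (a # v) r"
  obtains p' q where "path A p [] p'" "(p', Some a, q) \<in> trans A" "path A q v r"
proof -
  have "path A p w r \<Longrightarrow> w = a # v \<Longrightarrow>
      \<exists>p' q. path A p [] p' \<and> (p', Some a, q) \<in> trans A \<and> path A q v r" for w
    by (induction rule: path.induct) (auto intro: path.intros)
  with assms that show ?thesis by blast
qed

lemma closing_True_iff: "(p, q) \<in> (closing True A)\<^sup>* \<longleftrightarrow> path A p [] q"
proof
  show "(p, q) \<in> (closing True A)\<^sup>* \<Longrightarrow> path A p [] q"
    by (induction rule: converse_rtrancl_induct) (auto simp: closing_def intro: path.intros)
  have "path A p w q \<Longrightarrow> w = [] \<Longrightarrow> (p, q) \<in> (closing True A)\<^sup>*" for w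
    by (induction rule: path.induct)
      (auto simp: closing_def intro: converse_rtrancl_into_rtrancl)
  then show "path A p [] q \<Longrightarrow> (p, q) \<in> (closing True A)\<^sup>*" by blast
qed

lemma closing_False_iff: "(p, q) \<in> (closing False A)\<^sup>* \<longleftrightarrow> (\<exists>u. path A p u q)"
proof
  show "(p, q) \<in> (closing False A)\<^sup>* \<Longrightarrow> \<exists>u. path A p u q"
  proof (induction rule: converse_rtrancl_induct)
    case (step p p')
    then obtain x u where "(p, x, p') \<in> trans A" "path A p' u q"
      by (auto simp: closing_def)
    then show ?case by (cases x) (auto intro: path.intros)
  qed (auto intro: path.Nil)
  have "path A p u q \<Longrightarrow> (p, q) \<in> (closing False A)\<^sup>*" for u
    by (induction rule: path.induct)
      (auto simp: closing_def intro: converse_rtrancl_into_rtrancl)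
  then show "\<exists>u. path A p u q \<Longrightarrow> (p, q) \<in> (closing False A)\<^sup>*" by blast
qed

lemma subseq_snoc_iff: "subseq u (w @ [a]) \<longleftrightarrow> subseq u w \<or> (\<exists>v. u = v @ [a] \<and> subseq v w)"
proof
  assume "subseq u (w @ [a])"
  then obtain v x where "u = v @ x" "subseq v w" "subseq x [a]"
    by (auto elim: subseq_appendE)
  then show "subseq u w \<or> (\<exists>v. u = v @ [a] \<and> subseq v w)"
    by (cases x) (auto split: if_splits)
next
  show "subseq u w \<or> (\<exists>v. u = v @ [a] \<and> subseq v w) \<Longrightarrow> subseq u (w @ [a])"
    by (auto intro: subseq_order.trans list_emb_append_mono)
qed

lemma snoc_subseq_iff:
  "subseq (w @ [a]) u \<longleftrightarrow> (\<exists>v v'. u = v @ a # v' \<and> subseq w v)"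
proof
  assume "subseq (w @ [a]) u"
  then obtain v x where u: "u = v @ x" "subseq w v" "subseq [a] x"
    by (blast dest: list_emb_appendD)
  from u(3) obtain y z where "x = y @ a # z"
    by (auto simp: subseq_singleton_left dest: split_list)
  with u have "u = (v @ y) @ a # z" "subseq w (v @ y)"
    using list_emb_append_mono[OF u(2), of "[]" y] by simp_all
  then show "\<exists>v v'. u = v @ a # v' \<and> subseq w v" by blast
next
  assume "\<exists>v v'. u = v @ a # v' \<and> subseq w v"
  then show "subseq (w @ [a]) u" by (auto intro!: list_emb_append_mono)
qed

text \<open>A subsequence of \<open>w @ [a]\<close> either ignores the last letter or ends with it;
  these are the two parts united in \<open>next_set\<close>.\<close>

lemma reach_set_sub: "reach_set True A w = {q. \<exists>u. subseq u w \<and> path A (init A) u q}"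
proof (induction w rule: rev_induct)
  case Nil
  show ?case by (auto simp: closing_True_iff dest: list_emb_Nil2)
next
  case (snoc a w)
  show ?case
  proof (intro set_eqI iffI)
    fix q assume "q \<in> reach_set True A (w @ [a])"
    then obtain p where p: "p \<in> reach_set True A w \<union> succs A a (reach_set True A w)" "path A p [] q"
      unfolding reach_set_snoc next_set_def Image_iff closing_True_iff by auto
    show "q \<in> {q. \<exists>u. subseq u (w @ [a]) \<and> path A (init A) u q}"
    proof (cases "p \<in> reach_set True A w")
      case True
      with snoc obtain u where "subseq u w" "path A (init A) u p" by auto
      with path_append[OF this(2) p(2)] show ?thesis by (auto simp: subseq_snoc_iff)
    next
      case False
      with p(1) snoc obtain u p' where u: "subseq u w" "path A (init A) u p'" "(p', Some a, p) \<in> trans A"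
        by (auto simp: succs_def)
      have "path A (init A) (u @ [a]) q"
        using u(2) path.Sym[OF u(3) p(2)] by (rule path_append)
      with u(1) show ?thesis by (auto simp: subseq_snoc_iff)
    qed
  next
    fix q assume "q \<in> {q. \<exists>u. subseq u (w @ [a]) \<and> path A (init A) u q}"
    then consider u where "subseq u w" "path A (init A) u q"
      | u where "subseq u w" "path A (init A) (u @ [a]) q"
      by (auto simp: subseq_snoc_iff)
    then show "q \<in> reach_set True A (w @ [a])"
    proof cases
      case 1
      then show ?thesis using snoc by (auto simp: next_set_def)
    next
      case 2
      from 2(2) obtain p1 where p1: "path A (init A) u p1" "path A p1 [a] q"
        by (rule path_appendE)
      from p1(2) obtain p2 p3 where p: "path A p1 [] p2" "(p2, Some a, p3) \<in> trans A" "path A p3 [] q"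
        by (rule path_ConsE)
      have "path A (init A) u p2" using path_append[OF p1(1) p(1)] by simp
      then have "p2 \<in> reach_set True A w" using 2(1) snoc by auto
      with p(2,3) show ?thesis
        by (auto simp: next_set_def succs_def closing_True_iff)
    qed
  qed
qed

text \<open>A supersequence of \<open>w @ [a]\<close> is a supersequence of \<open>w\<close>, then
  an \<open>a\<close>, then an arbitrary rest, and the closure under all transitions provides the
  rest.\<close>

lemma reach_set_super: "reach_set False A w = {q. \<exists>u. subseq w u \<and> path A (init A) u q}"
proof (induction w rule: rev_induct)
  case Nil
  show ?case by (auto simp: closing_False_iff)
next
  case (snoc a w)
  show ?case
  proof (intro set_eqI iffI)
    fix q assume "q \<in> reach_set False A (w @ [a])"
    then obtain p p' v' where p: "p \<in> reach_set False A w" "(p, Some a, p') \<in> trans A" "path A p' v' q"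
      by (auto simp: next_set_def succs_def closing_False_iff)
    then obtain v where v: "subseq w v" "path A (init A) v p" using snoc by auto
    have "path A (init A) (v @ a # v') q"
      using v(2) path.Sym[OF p(2,3)] by (rule path_append)
    with v(1) show "q \<in> {q. \<exists>u. subseq (w @ [a]) u \<and> path A (init A) u q}"
      by (auto simp: snoc_subseq_iff)
  next
    fix q assume "q \<in> {q. \<exists>u. subseq (w @ [a]) u \<and> path A (init A) u q}"
    then obtain v v' where v: "subseq w v" "path A (init A) (v @ a # v') q"
      by (auto simp: snoc_subseq_iff)
    from v(2) obtain p1 where p1: "path A (init A) v p1" "path A p1 (a # v') q"
      by (rule path_appendE)
    from p1(2) obtain p2 p3 where p: "path A p1 [] p2" "(p2, Some a, p3) \<in> trans A" "path A p3 v' q"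
      by (rule path_ConsE)
    have "path A (init A) v p2" using path_append[OF p1(1) p(1)] by simp
    then have "p2 \<in> reach_set False A w" using v(1) snoc by auto
    moreover have "(p3, q) \<in> (closing False A)\<^sup>*"
      using p(3) by (auto simp: closing_False_iff)
    ultimately show "q \<in> reach_set False A (w @ [a])"
      using p(2) by (auto simp: next_set_def succs_def)
  qed
qed

section \<open>Monotonicity of the sets and bounds on the sizes\<close>

lemma reach_set_closed: "closing sub A `` reach_set sub A w \<subseteq> reach_set sub A w"
  by (cases w rule: rev_cases) (auto simp: next_set_def intro: rtrancl_into_rtrancl)

text \<open>The source of the bound on the number of changes. In the second case the closing
  relation contains every transition, so a closed set contains its successors under \<open>a\<close>
  together with their closure.\<close>

lemma next_set_mono:
  "sub \<Longrightarrow> S \<subseteq> next_set sub A a S"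
  "\<not> sub \<Longrightarrow> closing sub A `` S \<subseteq> S \<Longrightarrow> next_set sub A a S \<subseteq> S"
proof -
  assume *: "\<not> sub" "closing sub A `` S \<subseteq> S"
  have "succs A a S \<subseteq> S" using * by (auto simp: succs_def closing_def)
  then have "(closing sub A)\<^sup>* `` succs A a S \<subseteq> (closing sub A)\<^sup>* `` S" by blast
  with * show "next_set sub A a S \<subseteq> S"
    by (simp add: next_set_def Image_closed_trancl)
qed (auto simp: next_set_def)

lemma trans_in_states: "enfa A \<Longrightarrow> (p, x, q) \<in> trans A \<Longrightarrow> p \<in> states A \<and> q \<in> states A"
  unfolding enfa_def by blast

lemma path_in_states: "path A p u q \<Longrightarrow> enfa A \<Longrightarrow> p \<in> states A \<Longrightarrow> q \<in> states A"
  by (induction rule: path.induct) (auto dest: trans_in_states)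

lemma reach_set_subset:
  assumes "enfa A"
  shows "reach_set sub A w \<subseteq> states A"
proof -
  have "init A \<in> states A" using assms by (simp add: enfa_def)
  then have "path A (init A) u q \<Longrightarrow> q \<in> states A" for u q
    using assms path_in_states by metis
  then show ?thesis by (cases sub) (auto simp: reach_set_sub reach_set_super)
qed

lemma matching_iff_reach_set:
  "subsequence_matching A w \<longleftrightarrow> final A \<in> reach_set True A w"
  "supersequence_matching A w \<longleftrightarrow> final A \<in> reach_set False A w"
  unfolding subsequence_matching_def supersequence_matching_def reach_set_sub reach_set_super
    lang_def mem_Collect_eq by (rule refl)+

lemma path_final_transition: "path A p u q \<Longrightarrow> p = q \<or> (\<exists>p' x. (p', x, q) \<in> trans A)"
  by (induction rule: path.induct) auto

text \<open>Every state except the initial one is reached through some last transition, so it is a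
  target. This lets the loops over all states be charged to the transitions.\<close>

lemma card_states_le:
  assumes "enfa A" "trimmed A"
  shows "card (states A) \<le> Suc (card (trans A))"
proof -
  have fin: "finite (trans A)"
    using assms(1) unfolding enfa_def by (meson finite_SigmaI finite_imageI finite_insert finite_subset)
  have "states A \<subseteq> insert (init A) ((\<lambda>(p, x, q). q) ` trans A)"
  proof
    fix q assume "q \<in> states A"
    then obtain u where "path A (init A) u q" using assms(2) by (auto simp: trimmed_def)
    from path_final_transition[OF this]
    show "q \<in> insert (init A) ((\<lambda>(p, x, q). q) ` trans A)" by force
  qed
  then have "card (states A) \<le> card (insert (init A) ((\<lambda>(p, x, q). q) ` trans A))"
    using fin by (intro card_mono) auto
  also have "\<dots> \<le> Suc (card (trans A))"
    using fin by (metis card_image_le card_insert_le_m1 card_insert_if finite_imageI le_SucI Suc_le_mono)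
  finally show ?thesis .
qed

text \<open>A transition carries at most one symbol, so distinct symbols need distinct transitions.
  This lets the clearing of the marks be charged to the transitions.\<close>

lemma card_alphabet_le:
  assumes "enfa A" "all_symbols_used A"
  shows "card (alphabet A) \<le> card (trans A)"
proof -
  have fin: "finite (trans A)"
    using assms(1) unfolding enfa_def by (meson finite_SigmaI finite_imageI finite_insert finite_subset)
  have "alphabet A \<subseteq> (\<lambda>(p, x, q). the x) ` trans A"
    using assms(2) unfolding all_symbols_used_def by force
  then show ?thesis using fin by (metis surj_card_le)
qed

section \<open>The matching algorithm\<close>

text \<open>A state goes on the stack only at the moment when it enters \<open>New\<close>, so it is
  stacked at most once per search and the stack never exceeds \<open>n\<close> entries. The target
  is the third field of a transition, hence the offset 2.\<close>

definition push :: com where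
  "push =
     If (Eq (Rd New (Rd Inp (Plus (V Edge) (C 2)))) (C 0))
       (Write New (Rd Inp (Plus (V Edge) (C 2))) (C 1) ;;
        Write Stk (V Sp) (Rd Inp (Plus (V Edge) (C 2))) ;;
        Assign Sp (Plus (V Sp) (C 1)))
       Skip"

text \<open>A transition is named by the address of its first field. These addresses start at 6, so
  0 is free to mark the end of a list, and zeroed memory already represents empty lists. The index
  is built once and serves all searches.\<close>

definition build_index :: com where
  "build_index =
     Assign Edge (C 6) ;;
     While (Less (V Edge) (V TrEnd))
       (Write Nxt (V Edge) (Rd Head (Rd Inp (V Edge))) ;;
        Write Head (Rd Inp (V Edge)) (V Edge) ;;
        Assign Edge (Plus (V Edge) (C 3)))"

text \<open>The nested loops of a graph search are merged into one, so that a single potential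
  bounds the time: an iteration either handles one transition of the current state or, when
  \<open>Edge\<close> is 0 and its list is exhausted, pops the next state.\<close>

definition close_new :: "bool \<Rightarrow> com" where
  "close_new sub =
     Assign Edge (C 0) ;;
     While (Less (C 0) (Plus (V Sp) (V Edge)))
       (If (Less (C 0) (V Edge))
         ((if sub then If (Eq (Rd Inp (Plus (V Edge) (C 1))) (C 0)) push Skip else push) ;;
          Assign Edge (Rd Nxt (V Edge)))
         (Assign Sp (Minus (V Sp) (C 1)) ;;
          Assign Edge (Rd Head (Rd Stk (V Sp)))))"

text \<open>For subsequences the old set is copied without being stacked: it is closed already, so
  only states added to it have to be expanded.\<close>

definition reset_new :: "bool \<Rightarrow> com" where
  "reset_new sub =
     Assign Sp (C 0) ;;
     Assign St (C 1) ;;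
     While (Less (V St) (Plus (V NumQ) (C 1)))
       (Write New (V St) (if sub then Rd Cur (V St) else C 0) ;;
        Assign St (Plus (V St) (C 1)))"

text \<open>A scan of all transitions, with no index by letter: the search that follows may take
  time O(m) anyway.\<close>

definition seed_new :: com where
  "seed_new =
     Assign Edge (C 6) ;;
     While (Less (V Edge) (V TrEnd))
       (If (Eq (Rd Inp (Plus (V Edge) (C 1))) (V Sym))
          (If (Eq (Rd Cur (Rd Inp (V Edge))) (C 1)) push Skip) Skip ;;
        Assign Edge (Plus (V Edge) (C 3)))"

definition update_cur :: com where
  "update_cur =
     Assign Chg (C 0) ;;
     Assign St (C 1) ;;
     While (Less (V St) (Plus (V NumQ) (C 1)))
       (If (Eq (Rd New (V St)) (Rd Cur (V St))) Skip
          (Assign Chg (C 1) ;; Write Cur (V St) (Rd New (V St))) ;;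
        Assign St (Plus (V St) (C 1)))"

definition unmark_all :: com where
  "unmark_all =
     Assign St (C 1) ;;
     While (Less (V St) (Plus (Rd Inp (C 1)) (C 1)))
       (Write Mark (V St) (C 0) ;;
        Assign St (Plus (V St) (C 1)))"

definition recompute :: "bool \<Rightarrow> com" where
  "recompute sub =
     reset_new sub ;; seed_new ;; close_new sub ;; update_cur ;;
     If (Eq (V Chg) (C 0)) (Write Mark (V Sym) (C 1)) unmark_all"

definition read_word :: "bool \<Rightarrow> com" where
  "read_word sub =
     Assign Pos (V TrEnd) ;;
     While (Less (V Pos) (V InEnd))
       (Assign Sym (Rd Inp (V Pos)) ;;
        If (Eq (Rd Mark (V Sym)) (C 0)) (recompute sub) Skip ;;
        Assign Pos (Plus (V Pos) (C 1)))"

text \<open>\<open>Cur\<close> is still zero here and represents the empty set, so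
  \<open>update_cur\<close> acts as a copy from \<open>New\<close>.\<close>

definition start_set :: "bool \<Rightarrow> com" where
  "start_set sub =
     Write New (Rd Inp (C 4)) (C 1) ;;
     Write Stk (C 0) (Rd Inp (C 4)) ;;
     Assign Sp (C 1) ;;
     close_new sub ;; update_cur"

text \<open>Over the empty alphabet the product in the time bound vanishes, so even building the
  index would be too slow. The answer is then always yes: the final state is reachable, and only by
  the empty string.\<close>

definition matcher :: "bool \<Rightarrow> com" where
  "matcher sub =
     If (Eq (Rd Inp (C 1)) (C 0)) (Assign Ans (C 1))
       (Assign NumQ (Rd Inp (C 0)) ;;
        Assign TrEnd (Plus (C 6) (Plus (Rd Inp (C 2)) (Plus (Rd Inp (C 2)) (Rd Inp (C 2))))) ;;
        Assign InEnd (Plus (V TrEnd) (Rd Inp (C 3))) ;;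
        build_index ;; start_set sub ;; read_word sub ;;
        Assign Ans (Rd Cur (Rd Inp (C 5))))"

text \<open>Address of the last of the first \<open>k\<close> transitions that starts in \<open>q\<close>, or 0.\<close>

fun last_edge :: "(nat \<Rightarrow> nat) \<Rightarrow> nat \<Rightarrow> nat \<Rightarrow> nat" where
  "last_edge f 0 q = 0"
| "last_edge f (Suc k) q = (if f k = q then 6 + 3 * k else last_edge f k q)"

lemma last_edge_eq_0: "last_edge f k q = 0 \<Longrightarrow> t < k \<Longrightarrow> f t \<noteq> q"
  by (induction k) (auto simp: less_Suc_eq split: if_splits)

lemma last_edge_pos:
  assumes "0 < last_edge f k q"
  obtains t where "t < k" "last_edge f k q = 6 + 3 * t" "f t = q" "\<And>i. t < i \<Longrightarrow> i < k \<Longrightarrow> f i \<noteq> q"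
proof -
  from assms have "\<exists>t<k. last_edge f k q = 6 + 3 * t \<and> f t = q \<and> (\<forall>i. t < i \<and> i < k \<longrightarrow> f i \<noteq> q)"
    by (induction k) (auto simp: less_Suc_eq)
  with that show thesis by blast
qed

text \<open>The label of transition \<open>t\<close> is given by \<open>lab t\<close>, where 0 is the empty label.\<close>

locale encoded_instance =
  fixes sub :: bool and A :: "(nat, nat) enfa" and w :: "nat list"
    and inp src lab tgt :: "nat \<Rightarrow> nat" and n \<sigma> m N L :: nat
  assumes inp_head: "inp 0 = n" "inp 1 = \<sigma>" "inp 2 = m" "inp 3 = length w" "inp 4 = init A" "inp 5 = final A"
    and inp_trans: "\<And>t. t < m \<Longrightarrow> inp (6 + 3 * t) = src t"
      "\<And>t. t < m \<Longrightarrow> inp (6 + 3 * t + 1) = lab t" "\<And>t. t < m \<Longrightarrow> inp (6 + 3 * t + 2) = tgt t"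
    and inp_word: "\<And>k. k < length w \<Longrightarrow> inp (6 + 3 * m + k) = w ! k"
    and src: "\<And>t. t < m \<Longrightarrow> src t \<in> {1..n}" and tgt: "\<And>t. t < m \<Longrightarrow> tgt t \<in> {1..n}"
    and word: "\<And>k. k < length w \<Longrightarrow> w ! k \<in> {1..\<sigma>}"
    and init: "init A \<in> {1..n}" and final: "final A \<in> {1..n}"
    and reach: "\<And>v. reach_set sub A v \<subseteq> {1..n}"
    and closing: "\<And>p q. (p, q) \<in> closing sub A \<longleftrightarrow> (\<exists>t<m. src t = p \<and> tgt t = q \<and> (sub \<longrightarrow> lab t = 0))"
    and succs: "\<And>a S. 0 < a \<Longrightarrow> succs A a S = {tgt t |t. t < m \<and> lab t = a \<and> src t \<in> S}"
    and sizes: "n \<le> Suc m" "\<sigma> \<le> m" "N = 6 + 3 * m + length w" "7 * N \<le> L"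
begin

section \<open>State sets and transition lists as arrays\<close>

definition repr :: "(nat \<Rightarrow> nat) \<Rightarrow> nat set \<Rightarrow> bool" where
  "repr f S \<longleftrightarrow> S \<subseteq> {1..n} \<and> (\<forall>q\<in>{1..n}. f q = of_bool (q \<in> S))"

lemma repr_upd: "repr f S \<Longrightarrow> v \<in> {1..n} \<Longrightarrow> repr (f(v := 1)) (insert v S)"
  by (auto simp: repr_def)

lemma repr_eq_0: "repr f S \<Longrightarrow> v \<in> {1..n} \<Longrightarrow> f v = 0 \<longleftrightarrow> v \<notin> S"
  by (auto simp: repr_def)

lemma repr_eq_1: "repr f S \<Longrightarrow> v \<in> {1..n} \<Longrightarrow> f v = Suc 0 \<longleftrightarrow> v \<in> S"
  by (auto simp: repr_def)

lemma repr_card: "repr f S \<Longrightarrow> card S \<le> n"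
  unfolding repr_def using card_mono[of "{1..n}" S] by simp

lemma repr_finite: "repr f S \<Longrightarrow> finite S"
  unfolding repr_def using finite_subset by blast

lemma N_bounds: "n < N" "\<sigma> < N" "6 \<le> N" "t < m \<Longrightarrow> 6 + 3 * t + 2 < N"
  using sizes by auto

definition env :: "store \<Rightarrow> heap \<Rightarrow> bool" where
  "env r h \<longleftrightarrow> r NumQ = n \<and> r TrEnd = 6 + 3 * m \<and> r InEnd = N \<and> h Inp = inp"

text \<open>The link of transition \<open>t\<close> is the head that the list of
  \<open>src t\<close> had before \<open>t\<close> was inserted, so the lists run backwards through
  the input.\<close>

definition index :: "heap \<Rightarrow> bool" where
  "index h \<longleftrightarrow> (\<forall>q\<in>{1..n}. h Head q = last_edge src m q) \<and>
     (\<forall>t<m. h Nxt (6 + 3 * t) = last_edge src t (src t))"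

lemma env_frame:
  "env r h \<Longrightarrow> frame c r h r' h' \<Longrightarrow> mods c \<inter> {NumQ, TrEnd, InEnd} = {} \<Longrightarrow> Inp \<notin> writes c \<Longrightarrow>
    env r' h'"
  unfolding env_def frame_def by auto

lemma index_frame:
  "index h \<Longrightarrow> frame c r h r' h' \<Longrightarrow> writes c \<inter> {Head, Nxt} = {} \<Longrightarrow> index h'"
  unfolding index_def frame_def by auto

lemma wp_build_index:
  assumes "env r h" "\<forall>q\<in>{1..n}. h Head q = 0"
    and post: "\<And>t' r' h'. frame build_index r h r' h' \<Longrightarrow> index h' \<Longrightarrow> t' \<le> t + 50 * m + 10 \<Longrightarrow> Q t' r' h'"
  shows "wp N L build_index Q t r h"
proof -
  \<comment> \<open>50 exceeds the cost of one iteration, so this much potential for each remaining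
    transition pays for the loop. The loops below follow the same scheme with their own
    constants.\<close>
  define I where "I p r h \<longleftrightarrow> (\<exists>k\<le>m. r Edge = 6 + 3 * k \<and>
      (\<forall>q\<in>{1..n}. h Head q = last_edge src k q) \<and>
      (\<forall>t<k. h Nxt (6 + 3 * t) = last_edge src t (src t)) \<and> p = 50 * (m - k))"
    for p :: nat and r :: store and h :: heap
  have "6 < L" using sizes by simp
  let ?r = "r(Edge := 6)"
  have loop: "wp N L (While (Less (V Edge) (V TrEnd))
       (Write Nxt (V Edge) (Rd Head (Rd Inp (V Edge))) ;;
        Write Head (Rd Inp (V Edge)) (V Edge) ;;
        Assign Edge (Plus (V Edge) (C 3)))) Q (t + 2) ?r h"
    (is "wp N L (While ?g ?c) Q _ _ _")
  proof (rule wp_While)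
    show "I (50 * m) ?r h" using assms by (auto simp: I_def)
  next
    fix p r' h' assume I: "I p r' h'" and fr: "frame ?c ?r h r' h'"
    show "bsafe N L r' h' ?g" by simp
    have env: "env r' h'"
      using env_frame[OF _ fr] assms(1) by (simp add: env_def)
    from I obtain k where k: "k \<le> m" "r' Edge = 6 + 3 * k" "\<forall>q\<in>{1..n}. h' Head q = last_edge src k q"
      "\<forall>t<k. h' Nxt (6 + 3 * t) = last_edge src t (src t)" "p = 50 * (m - k)"
      by (auto simp: I_def)
    {
      assume "bval r' h' ?g"
      then have km: "k < m" using k(2) env by (simp add: env_def)
      have inp: "h' Inp (6 + 3 * k) = src k" "src k \<in> {1..n}"
        using env inp_trans(1)[OF km] src[OF km] by (simp_all add: env_def)
      let ?r'' = "r'(Edge := 6 + 3 * k + 3)"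
      let ?h'' = "h'(Nxt := (h' Nxt)(6 + 3 * k := h' Head (src k)), Head := (h' Head)(src k := 6 + 3 * k))"
      have "I (50 * (m - Suc k)) ?r'' ?h''"
        unfolding I_def using k(1,3,4) km inp by (intro exI[of _ "Suc k"]) (auto simp: less_Suc_eq)
      then have "\<exists>p'. I p' ?r'' ?h'' \<and> 50 + p' \<le> p"
        using k(5) km by (intro exI[of _ "50 * (m - Suc k)"]) auto
      then show "wp N L ?c (\<lambda>t r'' h''. \<exists>p'. I p' r'' h'' \<and> t + p' \<le> p) (bcost ?g + 1) r' h'"
        using inp N_bounds N_bounds(4)[OF km] sizes(4) k(2) by (auto elim!: ex_forward)
    }
    {
      fix t' assume "\<not> bval r' h' ?g" and t': "t' + p \<le> t + 2 + 50 * m + bcost ?g + 1"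
      then have "k = m" using k(1,2) env by (simp add: env_def)
      then have "index h'" using k by (simp add: index_def)
      moreover have "frame build_index r h r' h'"
        using fr by (auto simp: frame_def build_index_def)
      ultimately show "Q t' r' h'" using t' by (intro post) auto
    }
  qed
  then show ?thesis using \<open>6 < L\<close> by (simp add: build_index_def)
qed

section \<open>Graph search with a stack\<close>

definition stack :: "store \<Rightarrow> heap \<Rightarrow> nat set" where
  "stack r h = h Stk ` {..<r Sp}"

text \<open>Injectivity makes the height of the stack equal to the number of states on it, which is
  at most \<open>card S\<close>.\<close>

definition stacked :: "store \<Rightarrow> heap \<Rightarrow> nat set \<Rightarrow> bool" where
  "stacked r h S \<longleftrightarrow> repr (h New) S \<and> inj_on (h Stk) {..<r Sp} \<and> stack r h \<subseteq> S"

lemma stacked_Sp: "stacked r h S \<Longrightarrow> r Sp = card (stack r h)"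
  by (simp add: stacked_def stack_def card_image)

lemma stacked_Sp_le: "stacked r h S \<Longrightarrow> r Sp \<le> card S"
  unfolding stacked_Sp by (meson card_mono repr_finite stacked_def)

text \<open>The set and the stack grow by the same states. Their difference, the set of states
  already expanded, therefore stays the same.\<close>

lemma wp_push:
  assumes env: "env r h" and t: "i < m" "r Edge = 6 + 3 * i" and st: "stacked r h S"
    and post: "\<And>t' r' h'. frame push r h r' h' \<Longrightarrow> stacked r' h' (insert (tgt i) S) \<Longrightarrow>
      stack r' h' = stack r h \<union> ({tgt i} - S) \<Longrightarrow> r' Sp = r Sp + of_bool (tgt i \<notin> S) \<Longrightarrow>
      t' \<le> t + 50 \<Longrightarrow> Q t' r' h'"
  shows "wp N L push Q t r h"
proof -
  have inp: "h Inp (6 + 3 * i + 2) = tgt i" "tgt i \<in> {1..n}"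
    using env inp_trans(3)[OF t(1)] tgt[OF t(1)] by (simp_all add: env_def)
  have repr: "repr (h New) S" using st by (simp add: stacked_def)
  note bounds = N_bounds N_bounds(4)[OF t(1)] sizes(4)
  show ?thesis
  proof (cases "tgt i \<in> S")
    case True
    then have "Q t' r h" if "t' \<le> t + 50" for t'
      using st that by (intro post) (auto simp: frame_def insert_absorb)
    moreover have "h New (tgt i) = Suc 0" using repr True inp by (simp add: repr_eq_1)
    ultimately show ?thesis using bounds t(2) inp by (simp add: push_def)
  next
    case False
    \<comment> \<open>The set misses \<open>tgt i\<close>, hence has fewer than \<open>n\<close>
      states, and the stack has a free cell.\<close>
    have "card (insert (tgt i) S) \<le> n"
      using repr_card[OF repr_upd[OF repr inp(2)]] .
    then have "Suc (card S) \<le> n" using False repr_finite[OF repr] by simp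
    then have Sp: "r Sp < n" using stacked_Sp_le[OF st] by simp
    let ?r' = "r(Sp := r Sp + 1)"
    let ?h' = "h(New := (h New)(tgt i := 1), Stk := (h Stk)(r Sp := tgt i))"
    have stack: "stack ?r' ?h' = insert (tgt i) (stack r h)"
      by (auto simp: stack_def lessThan_Suc)
    have new: "h Stk x \<noteq> tgt i" if "x < r Sp" for x
      using st False that by (auto simp: stacked_def stack_def)
    have "inj_on ((h Stk)(r Sp := tgt i)) {..<Suc (r Sp)}"
    proof (rule inj_onI)
      fix x y assume "x \<in> {..<Suc (r Sp)}" "y \<in> {..<Suc (r Sp)}"
        "((h Stk)(r Sp := tgt i)) x = ((h Stk)(r Sp := tgt i)) y"
      moreover have "inj_on (h Stk) {..<r Sp}" using st by (simp add: stacked_def)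
      ultimately show "x = y"
        using new[of x] new[of y] by (auto simp: less_Suc_eq dest: inj_onD split: if_splits)
    qed
    then have "stacked ?r' ?h' (insert (tgt i) S)"
      using st repr_upd[OF repr inp(2)] stack by (auto simp: stacked_def)
    moreover have "frame push r h ?r' ?h'" by (auto simp: frame_def push_def)
    ultimately have "Q t' ?r' ?h'" if "t' \<le> t + 50" for t'
      using that False stack by (intro post) auto
    moreover have "h New (tgt i) = 0" using repr False inp by (simp add: repr_eq_0)
    ultimately show ?thesis using bounds t(2) inp Sp by (simp add: push_def)
  qed
qed

lemma wp_reset_new:
  assumes env: "env r h" and cur: "repr (h Cur) S"
    and post: "\<And>t' r' h'. frame (reset_new sub) r h r' h' \<Longrightarrow>
      stacked r' h' (if sub then S else {}) \<Longrightarrow> stack r' h' = {} \<Longrightarrow> t' \<le> t + 50 * n + 50 \<Longrightarrow> Q t' r' h'"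
  shows "wp N L (reset_new sub) Q t r h"
proof -
  define I where "I p r' h' \<longleftrightarrow> (\<exists>k\<le>n. r' St = Suc k \<and>
      (\<forall>q\<in>{1..k}. h' New q = (if sub then h Cur q else 0)) \<and> p = 50 * (n - k))"
    for p :: nat and r' :: store and h' :: heap
  let ?r = "r(Sp := 0, St := 1)"
  have loop: "wp N L (While (Less (V St) (Plus (V NumQ) (C 1)))
       (Write New (V St) (if sub then Rd Cur (V St) else C 0) ;;
        Assign St (Plus (V St) (C 1)))) Q (Suc (Suc (Suc (Suc t)))) ?r h"
    (is "wp N L (While ?g ?c) Q _ _ _")
  proof (rule wp_While)
    show "I (50 * n) ?r h" by (auto simp: I_def)
  next
    fix p r' h' assume I: "I p r' h'" and fr: "frame ?c ?r h r' h'"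
    have env: "env r' h'"
      using env_frame[OF _ fr] env by (simp add: env_def)
    have fr': "r' Sp = 0" "h' Cur = h Cur" using fr by (auto simp: frame_def)
    show "bsafe N L r' h' ?g" using env N_bounds(1) sizes(4) by (simp add: env_def)
    from I obtain k where k: "k \<le> n" "r' St = Suc k"
      "\<forall>q\<in>{1..k}. h' New q = (if sub then h Cur q else 0)" "p = 50 * (n - k)"
      by (auto simp: I_def)
    {
      assume "bval r' h' ?g"
      then have kn: "k < n" using k(2) env by (simp add: env_def)
      let ?r'' = "r'(St := Suc (Suc k))"
      let ?h'' = "h'(New := (h' New)(Suc k := if sub then h Cur (Suc k) else 0))"
      have "I (50 * (n - Suc k)) ?r'' ?h''"
        unfolding I_def using k(3) kn by (intro exI[of _ "Suc k"]) (auto simp: le_Suc_eq)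
      then have "\<exists>p'. I p' ?r'' ?h'' \<and> 50 + p' \<le> p"
        using k(4) kn by (intro exI[of _ "50 * (n - Suc k)"]) auto
      then show "wp N L ?c (\<lambda>t r'' h''. \<exists>p'. I p' r'' h'' \<and> t + p' \<le> p) (bcost ?g + 1) r' h'"
        using N_bounds sizes(4) k(2) kn fr' by (auto elim!: ex_forward)
    }
    {
      fix t' assume "\<not> bval r' h' ?g" and t': "t' + p \<le> Suc (Suc (Suc (Suc t))) + 50 * n + bcost ?g + 1"
      then have "k = n" using k(1,2) env by (simp add: env_def)
      then have "repr (h' New) (if sub then S else {})"
        using k(3) cur by (auto simp: repr_def)
      then have "stacked r' h' (if sub then S else {})" "stack r' h' = {}"
        using fr' by (auto simp: stacked_def stack_def)
      moreover have "frame (reset_new sub) r h r' h'"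
        using fr by (auto simp: frame_def reset_new_def)
      ultimately show "Q t' r' h'" using t' by (intro post) auto
    }
  qed
  then show ?thesis using N_bounds(3) sizes(4) by (cases sub) (simp_all add: reset_new_def)
qed

text \<open>The postcondition on the stack says that every state added beyond \<open>X\<close>
  awaits expansion. A positive \<open>Sym\<close> excludes the empty label, which is coded as
  0.\<close>

lemma wp_seed_new:
  assumes env: "env r h" and cur: "repr (h Cur) S" and st: "stacked r h X" "stack r h = {}"
    and sym: "0 < r Sym"
    and post: "\<And>t' r' h'. frame seed_new r h r' h' \<Longrightarrow> stacked r' h' (X \<union> succs A (r Sym) S) \<Longrightarrow>
      stack r' h' \<union> X = X \<union> succs A (r Sym) S \<Longrightarrow> t' \<le> t + 100 * m + 50 \<Longrightarrow> Q t' r' h'"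
  shows "wp N L seed_new Q t r h"
proof -
  define T where "T k = {tgt t |t. t < k \<and> lab t = r Sym \<and> src t \<in> S}" for k
  define I where "I p r' h' \<longleftrightarrow> (\<exists>k\<le>m. r' Edge = 6 + 3 * k \<and> stacked r' h' (X \<union> T k) \<and>
      stack r' h' \<union> X = X \<union> T k \<and> p = 100 * (m - k))"
    for p :: nat and r' :: store and h' :: heap
  have T_Suc: "T (Suc k) = (if lab k = r Sym \<and> src k \<in> S then insert (tgt k) (T k) else T k)" for k
    by (auto simp: T_def less_Suc_eq)
  let ?r = "r(Edge := 6)"
  have loop: "wp N L (While (Less (V Edge) (V TrEnd))
       (If (Eq (Rd Inp (Plus (V Edge) (C 1))) (V Sym))
          (If (Eq (Rd Cur (Rd Inp (V Edge))) (C 1)) push Skip) Skip ;;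
        Assign Edge (Plus (V Edge) (C 3)))) Q (t + 2) ?r h"
    (is "wp N L (While ?g ?c) Q _ _ _")
  proof (rule wp_While)
    show "I (100 * m) ?r h" using st by (auto simp: I_def T_def stacked_def stack_def)
  next
    fix p r' h' assume I: "I p r' h'" and fr: "frame ?c ?r h r' h'"
    show "bsafe N L r' h' ?g" by simp
    have env: "env r' h'"
      using env_frame[OF _ fr] env by (simp add: env_def push_def)
    have fr': "r' Sym = r Sym" "h' Cur = h Cur" using fr by (auto simp: frame_def push_def)
    from I obtain k where k: "k \<le> m" "r' Edge = 6 + 3 * k" "stacked r' h' (X \<union> T k)"
      "stack r' h' \<union> X = X \<union> T k" "p = 100 * (m - k)"
      by (auto simp: I_def)
    {
      assume "bval r' h' ?g"
      then have km: "k < m" using k(2) env by (simp add: env_def)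
      have inp: "h' Inp (6 + 3 * k) = src k" "h' Inp (6 + 3 * k + 1) = lab k" "src k \<in> {1..n}"
        using env inp_trans[OF km] src[OF km] by (simp_all add: env_def)
      have step: "\<exists>p'. I p' (r''(Edge := 9 + 3 * k)) h'' \<and> 100 + p' \<le> p"
        if "stacked r'' h'' (X \<union> T (Suc k))" "stack r'' h'' \<union> X = X \<union> T (Suc k)" for r'' h''
        using that km k(5) unfolding I_def
        by (intro exI[of _ "100 * (m - Suc k)"] conjI exI[of _ "Suc k"]) (auto simp: stacked_def stack_def)
      note bounds = N_bounds N_bounds(4)[OF km] sizes(4)
      show "wp N L ?c (\<lambda>t r'' h''. \<exists>p'. I p' r'' h'' \<and> t + p' \<le> p) (bcost ?g + 1) r' h'"
      proof (cases "lab k = r Sym \<and> src k \<in> S")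
        case True
        then have T: "T (Suc k) = insert (tgt k) (T k)" by (simp add: T_Suc)
        \<comment> \<open>The clock on arrival is left open up to 40, which hides the exact cost of
          the two tests.\<close>
        have "wp N L push (wp N L (Assign Edge (Plus (V Edge) (C 3)))
            (\<lambda>t r'' h''. \<exists>p'. I p' r'' h'' \<and> t + p' \<le> p)) t'' r' h'" if t'': "t'' \<le> 40" for t''
        proof (rule wp_push[OF env km k(2,3)])
          fix t' r'' h''
          assume *: "frame push r' h' r'' h''" "stacked r'' h'' (insert (tgt k) (X \<union> T k))"
            "stack r'' h'' = stack r' h' \<union> ({tgt k} - (X \<union> T k))" "t' \<le> t'' + 50"
          have "\<exists>p'. I p' (r''(Edge := 9 + 3 * k)) h'' \<and> 100 + p' \<le> p"
            using *(2,3) k(4) T by (intro step) auto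
          moreover have "r'' Edge = 6 + 3 * k" using *(1) k(2) by (simp add: frame_def push_def)
          ultimately show "wp N L (Assign Edge (Plus (V Edge) (C 3)))
              (\<lambda>t r'' h''. \<exists>p'. I p' r'' h'' \<and> t + p' \<le> p) t' r'' h''"
            using *(4) t'' bounds by (auto elim!: ex_forward)
        qed
        moreover have "h Cur (src k) = Suc 0" using True cur inp by (simp add: repr_eq_1)
        ultimately show ?thesis using inp k(2) bounds True fr' by simp
      next
        case False
        then have "T (Suc k) = T k" by (auto simp: T_Suc)
        then have "\<exists>p'. I p' (r'(Edge := 9 + 3 * k)) h' \<and> 100 + p' \<le> p"
          using k(3,4) by (intro step) auto
        moreover have "h Cur (src k) = Suc 0 \<longleftrightarrow> src k \<in> S" using cur inp by (simp add: repr_eq_1)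
        ultimately show ?thesis using inp k(2) bounds False fr' by (auto elim!: ex_forward)
      qed
    }
    {
      fix t' assume "\<not> bval r' h' ?g" and t': "t' + p \<le> t + 2 + 100 * m + bcost ?g + 1"
      then have "k = m" using k(1,2) env by (simp add: env_def)
      then have "T k = succs A (r Sym) S" by (simp add: succs[OF sym] T_def)
      moreover have "frame seed_new r h r' h'"
        using fr by (auto simp: frame_def seed_new_def)
      ultimately show "Q t' r' h'" using t' k(3,4) by (intro post) auto
    }
  qed
  then show ?thesis using N_bounds(3) sizes(4) by (simp add: seed_new_def)
qed

text \<open>States off the stack count as expanded, and the hypothesis \<open>closed\<close> says
  that their successors are already in the set. This covers both a start from one stacked state and
  a start from a closed set that is not stacked.\<close>

lemma wp_close_new:
  assumes env: "env r h" and index: "index h" and st: "stacked r h X"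
    and closed: "closing sub A `` (X - stack r h) \<subseteq> X"
    and post: "\<And>t' r' h'. frame (close_new sub) r h r' h' \<Longrightarrow>
      repr (h' New) ((closing sub A)\<^sup>* `` X) \<Longrightarrow> t' \<le> t + 100 * (n + m) + 50 \<Longrightarrow> Q t' r' h'"
  shows "wp N L (close_new sub) Q t r h"
proof -
  let ?E = "closing sub A"
  define unexpanded where "unexpanded Y = {t. t < m \<and> src t \<notin> Y}" for Y
  define pending where "pending k cur = {t. t < k \<and> src t = cur}" for k cur
  \<comment> \<open>\<open>Y\<close> holds the states found, \<open>cur\<close> is the state whose
    list is being walked, and \<open>pending\<close> collects its transitions not yet handled. A
    push raises \<open>card Y\<close> and \<open>Sp\<close> alike and so is free; each handled
    transition leaves \<open>pending\<close>; a pop lowers \<open>Sp\<close> and only moves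
    transitions from \<open>unexpanded\<close> to \<open>pending\<close>. Thus every iteration
    lowers the sum by 1.\<close>
  define I where "I p r' h' \<longleftrightarrow> (\<exists>Y k cur. stacked r' h' Y \<and> X \<subseteq> Y \<and> Y \<subseteq> ?E\<^sup>* `` X \<and> k \<le> m \<and>
      r' Edge = last_edge src k cur \<and> (0 < k \<longrightarrow> cur \<in> Y - stack r' h') \<and>
      (\<forall>t<m. (sub \<longrightarrow> lab t = 0) \<longrightarrow> src t \<in> Y - stack r' h' \<longrightarrow> tgt t \<in> Y \<or> t \<in> pending k cur) \<and>
      p = 100 * (n - card Y + r' Sp + card (unexpanded (Y - stack r' h')) + card (pending k cur)))"
    for p :: nat and r' :: store and h' :: heap
  have I_I: "I p r' h'" if "stacked r' h' Y" "X \<subseteq> Y" "Y \<subseteq> ?E\<^sup>* `` X" "k \<le> m"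
      "r' Edge = last_edge src k cur" "0 < k \<Longrightarrow> cur \<in> Y - stack r' h'"
      "\<And>t. t < m \<Longrightarrow> (sub \<longrightarrow> lab t = 0) \<Longrightarrow> src t \<in> Y - stack r' h' \<Longrightarrow> tgt t \<in> Y \<or> t \<in> pending k cur"
      "p = 100 * (n - card Y + r' Sp + card (unexpanded (Y - stack r' h')) + card (pending k cur))"
    for p r' h' Y k cur
    unfolding I_def using that by blast
  have fin: "finite (unexpanded Y)" "finite (pending k cur)" for Y k cur
    by (simp_all add: unexpanded_def pending_def)
  let ?r = "r(Edge := 0)"
  let ?p = "100 * (n - card X + r Sp + card (unexpanded (X - stack r h)))"
  have "card (unexpanded (X - stack r h)) \<le> card {..<m}"
    by (intro card_mono) (auto simp: unexpanded_def)
  moreover have "n - card X + r Sp \<le> n"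
    using stacked_Sp_le[OF st] repr_card[of "h New" X] st by (simp add: stacked_def)
  ultimately have p_le: "?p \<le> 100 * (n + m)" by simp
  have loop: "wp N L (While (Less (C 0) (Plus (V Sp) (V Edge)))
       (If (Less (C 0) (V Edge))
         ((if sub then If (Eq (Rd Inp (Plus (V Edge) (C 1))) (C 0)) push Skip else push) ;;
          Assign Edge (Rd Nxt (V Edge)))
         (Assign Sp (Minus (V Sp) (C 1)) ;;
          Assign Edge (Rd Head (Rd Stk (V Sp)))))) Q (Suc (Suc t)) ?r h"
    (is "wp N L (While ?g ?c) Q _ _ _")
  proof (rule wp_While)
    have "stack ?r h = stack r h" by (simp add: stack_def)
    moreover have "tgt i \<in> X" if "i < m" "sub \<longrightarrow> lab i = 0" "src i \<in> X - stack r h" for i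
      using that closed closing by blast
    \<comment> \<open>With \<open>k = 0\<close> nothing is pending and \<open>cur\<close> is a mere
      placeholder.\<close>
    ultimately show "I ?p ?r h"
      using st by (intro I_I[of ?r h X 0 0]) (auto simp: stacked_def pending_def)
  next
    fix p r' h' assume I: "I p r' h'" and fr: "frame ?c ?r h r' h'"
    have env': "env r' h'"
      using env_frame[OF _ fr] env by (simp add: env_def push_def)
    have index': "index h'"
      using index_frame[OF index fr] by (simp add: push_def)
    from I obtain Y k cur where Y: "stacked r' h' Y" "X \<subseteq> Y" "Y \<subseteq> ?E\<^sup>* `` X"
      and k: "k \<le> m" "r' Edge = last_edge src k cur" "0 < k \<longrightarrow> cur \<in> Y - stack r' h'"
      and finished: "\<And>t. t < m \<Longrightarrow> (sub \<longrightarrow> lab t = 0) \<Longrightarrow> src t \<in> Y - stack r' h' \<Longrightarrow>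
        tgt t \<in> Y \<or> t \<in> pending k cur"
      and p: "p = 100 * (n - card Y + r' Sp + card (unexpanded (Y - stack r' h')) + card (pending k cur))"
      unfolding I_def by blast
    have repr: "repr (h' New) Y" using Y(1) by (simp add: stacked_def)
    have Sp: "r' Sp \<le> n" using stacked_Sp_le[OF Y(1)] repr_card[OF repr] by simp
    have Edge: "r' Edge < N"
    proof (cases "r' Edge = 0")
      case False
      then obtain i where "i < k" "r' Edge = 6 + 3 * i"
        using last_edge_pos[of src k cur] k(2) by auto
      with k(1) N_bounds(4)[of i] show ?thesis by simp
    qed (use N_bounds in simp)
    note bounds = N_bounds sizes(4)
    show "bsafe N L r' h' ?g" using Sp Edge bounds by simp
    {
      assume "bval r' h' ?g"
      show "wp N L ?c (\<lambda>t r'' h''. \<exists>p'. I p' r'' h'' \<and> t + p' \<le> p) (bcost ?g + 1) r' h'"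
      proof (cases "0 < r' Edge")
        case True
        then have "0 < last_edge src k cur" using k(2) by simp
        then obtain i where i: "i < k" "last_edge src k cur = 6 + 3 * i" "src i = cur"
            "\<And>j. i < j \<Longrightarrow> j < k \<Longrightarrow> src j \<noteq> cur"
          by (rule last_edge_pos) blast
        then have im: "i < m" and e: "r' Edge = 6 + 3 * i" using k(1,2) by simp_all
        have cur: "cur \<in> Y - stack r' h'" using i(1) k(3) by simp
        \<comment> \<open>By the choice of \<open>i\<close>, no transition between \<open>i\<close>
          and \<open>k\<close> starts in \<open>cur\<close>.\<close>
        have "pending k cur = insert i (pending i cur)"
          using i(1,3,4) by (auto simp: pending_def) (metis linorder_neqE_nat)
        then have pend: "t \<in> pending k cur \<longleftrightarrow> t = i \<or> t \<in> pending i cur"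
            "card (pending k cur) = Suc (card (pending i cur))" for t
          using fin(2)[of i cur] by (auto simp: pending_def)
        have nxt: "h' Nxt (6 + 3 * i) = last_edge src i cur"
          using index' im i(3) by (auto simp: index_def)
        have inp: "h' Inp (6 + 3 * i + 1) = lab i"
          using env' inp_trans[OF im] by (simp add: env_def)
        have step: "\<exists>p'. I p' (r''(Edge := last_edge src i cur)) h'' \<and> 100 + p' \<le> p"
          if "stacked r'' h'' Y'" "Y \<subseteq> Y'" "Y' \<subseteq> ?E\<^sup>* `` X" "Y' - stack r'' h'' = Y - stack r' h'"
            "n - card Y' + r'' Sp = n - card Y + r' Sp" "(sub \<longrightarrow> lab i = 0) \<longrightarrow> tgt i \<in> Y'"
          for r'' h'' Y'
        proof -
          have stack: "stack (r''(Edge := last_edge src i cur)) h'' = stack r'' h''"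
            by (simp add: stack_def)
          have "I (100 * (n - card Y' + r'' Sp + card (unexpanded (Y' - stack r'' h'')) + card (pending i cur)))
              (r''(Edge := last_edge src i cur)) h''"
          proof (intro I_I[of _ h'' Y' i cur])
            show "tgt t \<in> Y' \<or> t \<in> pending i cur"
              if "t < m" "sub \<longrightarrow> lab t = 0" "src t \<in> Y' - stack (r''(Edge := last_edge src i cur)) h''" for t
              using that finished[of t] pend(1)[of t] \<open>Y' - stack r'' h'' = _\<close> \<open>Y \<subseteq> Y'\<close>
                \<open>_ \<longrightarrow> tgt i \<in> Y'\<close> stack by auto
          qed (use that Y(2) im cur stack in \<open>auto simp: stacked_def\<close>)
          then show ?thesis using that(4,5) pend(2) p by auto
        qed
        have pushed: "wp N L push (wp N L (Assign Edge (Rd Nxt (V Edge)))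
            (\<lambda>t r'' h''. \<exists>p'. I p' r'' h'' \<and> t + p' \<le> p)) t'' r' h'"
          if t'': "t'' \<le> 40" and lab: "sub \<longrightarrow> lab i = 0" for t''
        proof (rule wp_push[OF env' im e Y(1)])
          fix t' r'' h''
          assume *: "frame push r' h' r'' h''" "stacked r'' h'' (insert (tgt i) Y)"
            "stack r'' h'' = stack r' h' \<union> ({tgt i} - Y)" "r'' Sp = r' Sp + of_bool (tgt i \<notin> Y)"
            "t' \<le> t'' + 50"
          have "(cur, tgt i) \<in> ?E" using closing im i(3) lab by blast
          then have "tgt i \<in> ?E\<^sup>* `` X" using cur Y(3) by (auto intro: rtrancl_into_rtrancl)
          moreover have "insert (tgt i) Y - stack r'' h'' = Y - stack r' h'"
            using *(3) Y(1) by (auto simp: stacked_def)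
          moreover have "n - card (insert (tgt i) Y) + r'' Sp = n - card Y + r' Sp"
          proof (cases "tgt i \<in> Y")
            case False
            have "card (insert (tgt i) Y) \<le> n"
              using *(2) repr_card by (auto simp: stacked_def)
            then show ?thesis using False *(4) repr_finite[OF repr] by simp
          qed (use *(4) in \<open>simp add: insert_absorb\<close>)
          ultimately have "\<exists>p'. I p' (r''(Edge := last_edge src i cur)) h'' \<and> 100 + p' \<le> p"
            using *(2) Y(3) by (intro step[of r'' h'' "insert (tgt i) Y"]) auto
          moreover have "r'' Edge = 6 + 3 * i" "h'' Nxt = h' Nxt"
            using *(1) e by (auto simp: frame_def push_def)
          ultimately show "wp N L (Assign Edge (Rd Nxt (V Edge)))
              (\<lambda>t r'' h''. \<exists>p'. I p' r'' h'' \<and> t + p' \<le> p) t' r'' h''"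
            using *(5) t'' N_bounds(4)[OF im] nxt by (auto elim!: ex_forward)
        qed
        show ?thesis
        proof (cases "sub \<longrightarrow> lab i = 0")
          case True
          then show ?thesis
            using pushed e inp bounds N_bounds(4)[OF im] by (cases sub) auto
        next
          case False
          then have "\<exists>p'. I p' (r'(Edge := last_edge src i cur)) h' \<and> 100 + p' \<le> p"
            using Y by (intro step[of r' h' Y]) auto
          then show ?thesis
            using False e inp nxt bounds N_bounds(4)[OF im] by (auto elim!: ex_forward)
        qed
      next
        case False
        then have Edge: "r' Edge = 0" and pos: "0 < r' Sp" using \<open>bval r' h' ?g\<close> by simp_all
        define sp q where "sp = r' Sp - 1" and "q = h' Stk sp"
        have Sp': "r' Sp = Suc sp" using pos by (simp add: sp_def)
        have q: "q \<in> stack r' h'" by (simp add: stack_def q_def Sp')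
        then have qY: "q \<in> Y" "q \<in> {1..n}" using Y(1) repr by (auto simp: stacked_def repr_def)
        let ?r'' = "r'(Sp := sp, Edge := last_edge src m q)"
        \<comment> \<open>Stack entries are distinct, so the popped state does not occur deeper down
          and really leaves the stack.\<close>
        have "h' Stk x \<noteq> q" if "x < sp" for x
        proof
          assume "h' Stk x = q"
          then have "x = sp"
            using Y(1) that by (auto simp: stacked_def q_def Sp' dest: inj_onD[of _ _ x sp])
          with that show False by simp
        qed
        then have stack: "stack ?r'' h' = stack r' h' - {q}"
          by (auto simp: stack_def Sp' lessThan_Suc q_def)
        have st': "stacked ?r'' h' Y"
          using Y(1) stack by (auto simp: stacked_def Sp' inj_on_def)
        have pend: "pending k cur = {}"
          using last_edge_eq_0[of src k cur] Edge k(2) by (auto simp: pending_def)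
        let ?U = "unexpanded (Y - stack ?r'' h')"
        \<comment> \<open>The pop makes \<open>q\<close> an expanded state: exactly its transitions
          change from unexpanded to pending.\<close>
        have "unexpanded (Y - stack r' h') = ?U \<union> pending m q" "?U \<inter> pending m q = {}"
          using q qY stack by (auto simp: unexpanded_def pending_def)
        then have card: "card (unexpanded (Y - stack r' h')) = card ?U + card (pending m q)"
          by (simp add: card_Un_disjoint fin)
        have finished': "tgt t \<in> Y \<or> t \<in> pending m q"
          if "t < m" "sub \<longrightarrow> lab t = 0" "src t \<in> Y - stack ?r'' h'" for t
          using that finished[of t] pend stack by (cases "src t = q") (auto simp: pending_def)
        have "I (100 * (n - card Y + sp + card ?U + card (pending m q))) ?r'' h'"
          using st' Y(2,3) qY stack finished' by (intro I_I[of _ h' Y m q]) simp_all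
        then have "\<exists>p'. I p' ?r'' h' \<and> 100 + p' \<le> p"
          using p card pend Sp'
          by (intro exI[of _ "100 * (n - card Y + sp + card ?U + card (pending m q))"]) simp
        moreover have "h' Head q = last_edge src m q" using index' qY by (simp add: index_def)
        moreover have "r' Sp - Suc 0 = sp" "h' Stk sp = q" by (simp_all add: sp_def q_def)
        ultimately show ?thesis
          using Edge Sp Sp' qY bounds by (auto elim!: ex_forward)
      qed
    }
    {
      fix t' assume exit: "\<not> bval r' h' ?g" and t': "t' + p \<le> Suc (Suc t) + ?p + bcost ?g + 1"
      then have "stack r' h' = {}" and "last_edge src k cur = 0"
        using k(2) by (simp_all add: stack_def)
      then have "pending k cur = {}"
        using last_edge_eq_0[of src k cur] by (auto simp: pending_def)
      \<comment> \<open>With nothing stacked or pending, \<open>Y\<close> is closed; lying between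
        \<open>X\<close> and the closure of \<open>X\<close>, it equals that closure.\<close>
      then have "?E `` Y \<subseteq> Y" using finished closing \<open>stack r' h' = {}\<close> by auto
      then have "?E\<^sup>* `` X = Y"
        using Y(2,3) Image_closed_trancl[of ?E Y] by blast
      moreover have "frame (close_new sub) r h r' h'"
        using fr by (auto simp: frame_def close_new_def)
      ultimately show "Q t' r' h'" using t' p_le repr by (intro post) auto
    }
  qed
  then show ?thesis using N_bounds(3) sizes(4) by (cases sub) (simp_all add: close_new_def)
qed

section \<open>Replacing the current set and maintaining the marks\<close>

lemma wp_update_cur:
  assumes env: "env r h" and cur: "repr (h Cur) S" and new: "repr (h New) S'"
    and post: "\<And>t' r' h'. frame update_cur r h r' h' \<Longrightarrow> repr (h' Cur) S' \<Longrightarrow>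
      r' Chg = of_bool (S \<noteq> S') \<Longrightarrow> t' \<le> t + 50 * n + 50 \<Longrightarrow> Q t' r' h'"
  shows "wp N L update_cur Q t r h"
proof -
  define I where "I p r' h' \<longleftrightarrow> (\<exists>k\<le>n. r' St = Suc k \<and>
      (\<forall>q\<in>{1..n}. h' Cur q = (if q \<le> k then h New q else h Cur q)) \<and>
      r' Chg = of_bool (\<exists>q\<in>{1..k}. h New q \<noteq> h Cur q) \<and> p = 50 * (n - k))"
    for p :: nat and r' :: store and h' :: heap
  let ?r = "r(Chg := 0, St := 1)"
  have loop: "wp N L (While (Less (V St) (Plus (V NumQ) (C 1)))
       (If (Eq (Rd New (V St)) (Rd Cur (V St))) Skip
          (Assign Chg (C 1) ;; Write Cur (V St) (Rd New (V St))) ;;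
        Assign St (Plus (V St) (C 1)))) Q (Suc (Suc (Suc (Suc t)))) ?r h"
    (is "wp N L (While ?g ?c) Q _ _ _")
  proof (rule wp_While)
    show "I (50 * n) ?r h" by (auto simp: I_def)
  next
    fix p r' h' assume I: "I p r' h'" and fr: "frame ?c ?r h r' h'"
    have env: "env r' h'"
      using env_frame[OF _ fr] env by (simp add: env_def)
    have fr': "h' New = h New" using fr by (auto simp: frame_def)
    show "bsafe N L r' h' ?g" using env N_bounds(1) sizes(4) by (simp add: env_def)
    from I obtain k where k: "k \<le> n" "r' St = Suc k"
      "\<forall>q\<in>{1..n}. h' Cur q = (if q \<le> k then h New q else h Cur q)"
      "r' Chg = of_bool (\<exists>q\<in>{1..k}. h New q \<noteq> h Cur q)" "p = 50 * (n - k)"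
      by (auto simp: I_def)
    {
      assume "bval r' h' ?g"
      then have kn: "k < n" using k(2) env by (simp add: env_def)
      have cur_k: "h' Cur (Suc k) = h Cur (Suc k)" using k(3) kn by simp
      have step: "\<exists>p'. I p' r'' h'' \<and> 50 + p' \<le> p"
        if "r'' St = Suc (Suc k)" "h'' Cur = (h' Cur)(Suc k := h New (Suc k))"
          "r'' Chg = (if h New (Suc k) = h Cur (Suc k) then r' Chg else 1)" for r'' h''
      proof -
        have "{1..Suc k} = insert (Suc k) {1..k}" by auto
        then have "I (50 * (n - Suc k)) r'' h''"
          unfolding I_def using that k(3,4) kn
          by (intro exI[of _ "Suc k"]) (auto simp: le_Suc_eq)
        then show ?thesis using k(5) kn by (intro exI[of _ "50 * (n - Suc k)"]) simp
      qed
      show "wp N L ?c (\<lambda>t r'' h''. \<exists>p'. I p' r'' h'' \<and> t + p' \<le> p) (bcost ?g + 1) r' h'"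
      proof (cases "h New (Suc k) = h Cur (Suc k)")
        case True
        then have "\<exists>p'. I p' (r'(St := Suc (Suc k))) h' \<and> 50 + p' \<le> p"
          using cur_k by (intro step) auto
        then show ?thesis
          using True N_bounds sizes(4) k(2) kn fr' cur_k by (auto elim!: ex_forward)
      next
        case False
        then have "\<exists>p'. I p' (r'(Chg := Suc 0, St := Suc (Suc k)))
            (h'(Cur := (h' Cur)(Suc k := h New (Suc k)))) \<and> 50 + p' \<le> p"
          by (intro step) auto
        then show ?thesis
          using False N_bounds sizes(4) k(2) kn fr' cur_k by (auto elim!: ex_forward)
      qed
    }
    {
      fix t' assume "\<not> bval r' h' ?g" and t': "t' + p \<le> Suc (Suc (Suc (Suc t))) + 50 * n + bcost ?g + 1"
      then have kn: "k = n" using k(1,2) env by (simp add: env_def)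
      have "repr (h' Cur) S'" using k(3) new by (auto simp: repr_def kn)
      moreover have "(\<exists>q\<in>{1..n}. h New q \<noteq> h Cur q) \<longleftrightarrow> S \<noteq> S'"
        using cur new by (auto simp: repr_def)
      then have "r' Chg = of_bool (S \<noteq> S')" using k(4) by (simp add: kn)
      moreover have "frame update_cur r h r' h'"
        using fr by (auto simp: frame_def update_cur_def)
      ultimately show "Q t' r' h'" using t' by (intro post) auto
    }
  qed
  then show ?thesis using N_bounds(3) sizes(4) by (simp add: update_cur_def)
qed

lemma wp_unmark_all:
  assumes env: "env r h"
    and post: "\<And>t' r' h'. frame unmark_all r h r' h' \<Longrightarrow> \<forall>a\<in>{1..\<sigma>}. h' Mark a = 0 \<Longrightarrow>
      t' \<le> t + 50 * \<sigma> + 50 \<Longrightarrow> Q t' r' h'"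
  shows "wp N L unmark_all Q t r h"
proof -
  define I where "I p r' h' \<longleftrightarrow> (\<exists>k\<le>\<sigma>. r' St = Suc k \<and>
      (\<forall>a\<in>{1..k}. h' Mark a = 0) \<and> p = 50 * (\<sigma> - k))"
    for p :: nat and r' :: store and h' :: heap
  let ?r = "r(St := 1)"
  have loop: "wp N L (While (Less (V St) (Plus (Rd Inp (C 1)) (C 1)))
       (Write Mark (V St) (C 0) ;;
        Assign St (Plus (V St) (C 1)))) Q (Suc (Suc t)) ?r h"
    (is "wp N L (While ?g ?c) Q _ _ _")
  proof (rule wp_While)
    show "I (50 * \<sigma>) ?r h" by (auto simp: I_def)
  next
    fix p r' h' assume I: "I p r' h'" and fr: "frame ?c ?r h r' h'"
    have env: "env r' h'"
      using env_frame[OF _ fr] env by (simp add: env_def)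
    then have inp: "h' Inp (Suc 0) = \<sigma>" using inp_head by (simp add: env_def)
    then show "bsafe N L r' h' ?g" using N_bounds sizes(4) by simp
    from I obtain k where k: "k \<le> \<sigma>" "r' St = Suc k" "\<forall>a\<in>{1..k}. h' Mark a = 0" "p = 50 * (\<sigma> - k)"
      by (auto simp: I_def)
    {
      assume "bval r' h' ?g"
      then have kn: "k < \<sigma>" using k(2) inp by simp
      let ?r'' = "r'(St := Suc (Suc k))" and ?h'' = "h'(Mark := (h' Mark)(Suc k := 0))"
      have "I (50 * (\<sigma> - Suc k)) ?r'' ?h''"
        unfolding I_def using k(3) kn by (intro exI[of _ "Suc k"]) (auto simp: le_Suc_eq)
      then have "\<exists>p'. I p' ?r'' ?h'' \<and> 50 + p' \<le> p"
        using k(4) kn by (intro exI[of _ "50 * (\<sigma> - Suc k)"]) auto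
      then show "wp N L ?c (\<lambda>t r'' h''. \<exists>p'. I p' r'' h'' \<and> t + p' \<le> p) (bcost ?g + 1) r' h'"
        using N_bounds sizes(4) k(2) kn by (auto elim!: ex_forward)
    }
    {
      fix t' assume "\<not> bval r' h' ?g" and t': "t' + p \<le> Suc (Suc t) + 50 * \<sigma> + bcost ?g + 1"
      then have "k = \<sigma>" using k(1,2) inp by simp
      moreover have "frame unmark_all r h r' h'"
        using fr by (auto simp: frame_def unmark_all_def)
      ultimately show "Q t' r' h'" using t' k(3) by (intro post) auto
    }
  qed
  then show ?thesis using N_bounds(3) sizes(4) by (simp add: unmark_all_def)
qed

lemmas com_defs = reset_new_def seed_new_def close_new_def update_cur_def unmark_all_def push_def

text \<open>The case distinction in \<open>post\<close> is what amortization needs: a recomputation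
  either gains a mark or witnesses a change of the set, and only a change loses marks.\<close>

lemma wp_recompute:
  assumes env: "env r h" and index: "index h" and cur: "repr (h Cur) S"
    and closed: "closing sub A `` S \<subseteq> S" and sym: "r Sym \<in> {1..\<sigma>}"
    and post: "\<And>t' r' h'. frame (recompute sub) r h r' h' \<Longrightarrow>
      repr (h' Cur) (next_set sub A (r Sym) S) \<Longrightarrow>
      (if next_set sub A (r Sym) S = S then h' Mark = (h Mark)(r Sym := 1)
       else \<forall>a\<in>{1..\<sigma>}. h' Mark a = 0) \<Longrightarrow>
      t' \<le> t + 300 * (n + m + \<sigma> + 1) \<Longrightarrow> Q t' r' h'"
  shows "wp N L (recompute sub) Q t r h"
proof -
  define X where "X = (if sub then S else {})"
  let ?X = "X \<union> succs A (r Sym) S" and ?S' = "next_set sub A (r Sym) S"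
  have "closing sub A `` X \<subseteq> X" using closed by (cases sub) (simp_all add: X_def)
  show ?thesis
    unfolding recompute_def wp_Seq
  proof (rule wp_reset_new[OF env cur])
    fix t1 r1 h1
    assume 1: "frame (reset_new sub) r h r1 h1" "stacked r1 h1 (if sub then S else {})"
      "stack r1 h1 = {}" "t1 \<le> t + 50 * n + 50"
    have f1: "env r1 h1" "index h1" "h1 Cur = h Cur" "r1 Sym = r Sym" "h1 Mark = h Mark"
      using env_frame[OF env 1(1)] index_frame[OF index 1(1)] 1(1) by (auto simp: com_defs frame_def)
    show "wp N L seed_new (wp N L (close_new sub) (wp N L update_cur
      (wp N L (If (Eq (V Chg) (C 0)) (Write Mark (V Sym) (C 1)) unmark_all) Q))) t1 r1 h1"
    proof (rule wp_seed_new[OF f1(1) _ 1(2,3), folded X_def])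
      show "repr (h1 Cur) S" "0 < r1 Sym" using f1 cur sym by auto
    next
      fix t2 r2 h2
      assume 2: "frame seed_new r1 h1 r2 h2" "stacked r2 h2 (X \<union> succs A (r1 Sym) S)"
        "stack r2 h2 \<union> X = X \<union> succs A (r1 Sym) S" "t2 \<le> t1 + 100 * m + 50"
      have f2: "env r2 h2" "index h2" "h2 Cur = h Cur" "r2 Sym = r Sym" "h2 Mark = h Mark"
        using env_frame[OF f1(1) 2(1)] index_frame[OF f1(2) 2(1)] 2(1) f1 by (auto simp: com_defs frame_def)
      \<comment> \<open>Whatever is off the stack lies in \<open>X\<close>, which is
        \<open>S\<close> or empty and closed in either case.\<close>
      have "closing sub A `` (?X - stack r2 h2) \<subseteq> closing sub A `` X"
        using 2(3) f1(4) by (intro Image_mono) auto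
      with \<open>closing sub A `` X \<subseteq> X\<close> have closed2: "closing sub A `` (?X - stack r2 h2) \<subseteq> ?X" by blast
      have st2: "stacked r2 h2 ?X" using 2(2) f1(4) by simp
      show "wp N L (close_new sub) (wp N L update_cur
        (wp N L (If (Eq (V Chg) (C 0)) (Write Mark (V Sym) (C 1)) unmark_all) Q)) t2 r2 h2"
      proof (rule wp_close_new[OF f2(1,2) st2 closed2])
        fix t3 r3 h3
        assume 3: "frame (close_new sub) r2 h2 r3 h3" "repr (h3 New) ((closing sub A)\<^sup>* `` ?X)"
          "t3 \<le> t2 + 100 * (n + m) + 50"
        have f3: "env r3 h3" "index h3" "h3 Cur = h Cur" "r3 Sym = r Sym" "h3 Mark = h Mark"
          using env_frame[OF f2(1) 3(1)] index_frame[OF f2(2) 3(1)] 3(1) f2 by (auto simp: com_defs frame_def)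
        have new: "repr (h3 New) ?S'" using 3(2) by (simp add: next_set_def X_def)
        show "wp N L update_cur
          (wp N L (If (Eq (V Chg) (C 0)) (Write Mark (V Sym) (C 1)) unmark_all) Q) t3 r3 h3"
        proof (rule wp_update_cur[OF f3(1) _ new])
          show "repr (h3 Cur) S" using cur f3 by simp
        next
          fix t4 r4 h4
          assume 4: "frame update_cur r3 h3 r4 h4" "repr (h4 Cur) ?S'"
            "r4 Chg = of_bool (S \<noteq> ?S')" "t4 \<le> t3 + 50 * n + 50"
          have f4: "env r4 h4" "r4 Sym = r Sym" "h4 Mark = h Mark"
            using env_frame[OF f3(1) 4(1)] 4(1) f3 by (auto simp: com_defs frame_def)
          have fr4: "frame (recompute sub) r h r4 h4"
            using 1(1) 2(1) 3(1) 4(1) by (auto simp: recompute_def frame_def)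
          have t4: "t4 \<le> t + 200 * n + 200 * m + 200" using 1(4) 2(4) 3(3) 4(4) by simp
          show "wp N L (If (Eq (V Chg) (C 0)) (Write Mark (V Sym) (C 1)) unmark_all) Q t4 r4 h4"
          proof (cases "?S' = S")
            case True
            have "Q t' r4 (h4(Mark := (h4 Mark)(r Sym := Suc 0)))" if "t' \<le> t4 + 10" for t'
              using that t4 fr4 4(2) True f4 by (intro post) (auto simp: frame_def recompute_def)
            then show ?thesis
              using True 4(3) f4(2) sym N_bounds sizes(4) by simp
          next
            case False
            have "wp N L unmark_all Q t5 r4 h4" if t5: "t5 \<le> t4 + 10" for t5
            proof (rule wp_unmark_all[OF f4(1)])
              fix t' r' h'
              assume 5: "frame unmark_all r4 h4 r' h'" "\<forall>a\<in>{1..\<sigma>}. h' Mark a = 0" "t' \<le> t5 + 50 * \<sigma> + 50"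
              have "h' Cur = h4 Cur" using 5(1) by (simp add: frame_def unmark_all_def)
              moreover have "frame (recompute sub) r h r' h'"
                using fr4 5(1) by (auto simp: recompute_def frame_def)
              ultimately show "Q t' r' h'"
                using 5 t5 t4 4(2) False by (intro post) auto
            qed
            then show ?thesis using False 4(3) N_bounds sizes(4) by auto
          qed
        qed
      qed
    qed
  qed
qed

section \<open>Amortized number of recomputations\<close>

definition remaining :: "nat set \<Rightarrow> nat" where
  "remaining S = (if sub then n - card S else card S)"

lemma remaining_le: "S \<subseteq> {1..n} \<Longrightarrow> remaining S \<le> n"
  unfolding remaining_def using card_mono[of "{1..n}" S] by simp

text \<open>Monotonicity turns any change into a strict inclusion, so \<open>remaining\<close>
  bounds the number of changes still to come.\<close>

lemma remaining_next_set:
  assumes "closing sub A `` S \<subseteq> S" "S \<subseteq> {1..n}" "next_set sub A a S \<subseteq> {1..n}" "next_set sub A a S \<noteq> S"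
  shows "remaining (next_set sub A a S) < remaining S"
proof -
  let ?S' = "next_set sub A a S"
  have fin: "finite S" "finite ?S'" using assms(2,3) by (auto intro: finite_subset)
  have "card ?S' \<le> n" using assms(3) card_mono[of "{1..n}" ?S'] by simp
  show ?thesis
  proof (cases sub)
    case True
    then have "S \<subset> ?S'" using next_set_mono(1)[OF True, of S A a] assms(4) by auto
    then have "card S < card ?S'" using fin by (intro psubset_card_mono)
    with True \<open>card ?S' \<le> n\<close> show ?thesis unfolding remaining_def by simp
  next
    case False
    then have "?S' \<subset> S" using next_set_mono(2)[OF False assms(1), of a] assms(4) by blast
    then have "card ?S' < card S" using fin by (intro psubset_card_mono)
    with False show ?thesis unfolding remaining_def by simp
  qed
qed

lemma wp_read_word:
  assumes env: "env r h" and index: "index h" and cur: "repr (h Cur) (reach_set sub A [])"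
    and mark: "\<forall>a\<in>{1..\<sigma>}. h Mark a = 0"
    and post: "\<And>t' r' h'. frame (read_word sub) r h r' h' \<Longrightarrow> repr (h' Cur) (reach_set sub A w) \<Longrightarrow>
      t' \<le> t + 50 * length w + 400 * (n + m + \<sigma> + 1) * (\<sigma> + (\<sigma> + 1) * n) + 50 \<Longrightarrow> Q t' r' h'"
  shows "wp N L (read_word sub) Q t r h"
proof -
  define S where "S k = reach_set sub A (take k w)" for k
  have S_sub: "S k \<subseteq> {1..n}" for k unfolding S_def by (rule reach)
  define D where "D = 400 * (n + m + \<sigma> + 1)"
  define unmarked where "unmarked f = {a \<in> {1..\<sigma>}. f a = 0}" for f :: "nat \<Rightarrow> nat"
  \<comment> \<open>The number of recomputations still affordable. One that leaves the set unchanged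
    removes an unmarked letter. One that changes it may restore up to \<sigma> unmarked letters, and
    the factor \<sigma> + 1 pays for these and for the recomputation itself.\<close>
  define credit where "credit f k = card (unmarked f) + (\<sigma> + 1) * remaining (S k)" for f k
  \<comment> \<open>A nonzero mark certifies that its letter fixes the current set, which justifies
    skipping it. Each letter of the word brings 50 units of potential, and each credit brings
    \<open>D\<close> for a recomputation.\<close>
  define I where "I p r' h' \<longleftrightarrow> (\<exists>k\<le>length w. r' Pos = 6 + 3 * m + k \<and> repr (h' Cur) (S k) \<and>
      (\<forall>a\<in>{1..\<sigma>}. h' Mark a = 0 \<or> next_set sub A a (S k) = S k) \<and>
      p = 50 * (length w - k) + D * credit (h' Mark) k)"
    for p :: nat and r' :: store and h' :: heap
  have unmarked_le: "card (unmarked f) \<le> \<sigma>" for f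
  proof -
    have "unmarked f \<subseteq> {1..\<sigma>}" by (auto simp: unmarked_def)
    from card_mono[OF _ this] show ?thesis by simp
  qed
  have fin: "finite (unmarked f)" for f by (simp add: unmarked_def)
  have credit0: "credit f 0 \<le> \<sigma> + (\<sigma> + 1) * n" for f
  proof -
    have "remaining (S 0) \<le> n" unfolding S_def by (rule remaining_le[OF reach])
    then show ?thesis
      unfolding credit_def using unmarked_le[of f] by (intro add_mono mult_left_mono) simp_all
  qed
  let ?r = "r(Pos := 6 + 3 * m)"
  let ?p = "50 * length w + D * credit (h Mark) 0"
  have p_le: "?p \<le> 50 * length w + D * (\<sigma> + (\<sigma> + 1) * n)" using credit0 by simp
  have loop: "wp N L (While (Less (V Pos) (V InEnd))
       (Assign Sym (Rd Inp (V Pos)) ;;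
        If (Eq (Rd Mark (V Sym)) (C 0)) (recompute sub) Skip ;;
        Assign Pos (Plus (V Pos) (C 1)))) Q (Suc (Suc t)) ?r h"
    (is "wp N L (While ?g ?c) Q _ _ _")
  proof (rule wp_While)
    show "I ?p ?r h" using cur mark by (auto simp: I_def S_def)
  next
    fix p r' h' assume I: "I p r' h'" and fr: "frame ?c ?r h r' h'"
    show "bsafe N L r' h' ?g" by simp
    have env': "env r' h'"
      using env_frame[OF _ fr] env by (simp add: env_def recompute_def com_defs)
    have index': "index h'"
      using index_frame[OF index fr] by (simp add: recompute_def com_defs)
    have InEnd: "r' InEnd = 6 + 3 * m + length w"
      using env' sizes(3) unfolding env_def by simp
    from I obtain k where k: "k \<le> length w" "r' Pos = 6 + 3 * m + k" "repr (h' Cur) (S k)"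
      "\<forall>a\<in>{1..\<sigma>}. h' Mark a = 0 \<or> next_set sub A a (S k) = S k"
      "p = 50 * (length w - k) + D * credit (h' Mark) k"
      by (auto simp: I_def)
    {
      assume "bval r' h' ?g"
      then have kl: "k < length w" using k(2) InEnd by simp
      define a where "a = w ! k"
      have a: "a \<in> {1..\<sigma>}" using word[OF kl] by (simp add: a_def)
      have inp: "h' Inp (6 + 3 * m + k) = a" using env' inp_word[OF kl] by (simp add: env_def a_def)
      have "take (Suc k) w = take k w @ [a]" using kl by (simp add: a_def take_Suc_conv_app_nth)
      then have S_Suc: "S (Suc k) = next_set sub A a (S k)" by (simp add: S_def)
      have bounds: "6 + 3 * m + k < N" "a < N" "6 + 3 * m + k + 1 < L" "0 < L"
        using kl a sizes N_bounds by auto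
      have step: "\<exists>p'. I p' (r''(Pos := Suc (6 + 3 * m + k))) h'' \<and> x + 50 + p' \<le> p"
        if "repr (h'' Cur) (S (Suc k))" "\<forall>a\<in>{1..\<sigma>}. h'' Mark a = 0 \<or> next_set sub A a (S (Suc k)) = S (Suc k)"
          "x + D * credit (h'' Mark) (Suc k) \<le> D * credit (h' Mark) k" for r'' h'' x
      proof -
        have "I (50 * (length w - Suc k) + D * credit (h'' Mark) (Suc k)) (r''(Pos := Suc (6 + 3 * m + k))) h''"
          unfolding I_def using that(1,2) kl by (intro exI[of _ "Suc k"]) simp
        then show ?thesis using that(3) k(5) kl
          by (intro exI[of _ "50 * (length w - Suc k) + D * credit (h'' Mark) (Suc k)"]) simp
      qed
      let ?r = "r'(Sym := a)"
      show "wp N L ?c (\<lambda>t r'' h''. \<exists>p'. I p' r'' h'' \<and> t + p' \<le> p) (bcost ?g + 1) r' h'"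
      proof (cases "h' Mark a = 0")
        case False
        then have "next_set sub A a (S k) = S k" using bspec[OF k(4) a] False by (elim disjE) simp_all
        then have "S (Suc k) = S k" by (simp add: S_Suc)
        then have "\<exists>p'. I p' (?r(Pos := Suc (6 + 3 * m + k))) h' \<and> 0 + 50 + p' \<le> p"
          using k(3,4) by (intro step) (simp_all add: credit_def)
        then show ?thesis
          using False inp bounds k(2) by (auto elim!: ex_forward)
      next
        case True
        have "wp N L (recompute sub) (wp N L (Assign Pos (Plus (V Pos) (C 1)))
            (\<lambda>t r'' h''. \<exists>p'. I p' r'' h'' \<and> t + p' \<le> p)) t'' ?r h'" if t'': "t'' \<le> 30" for t''
        proof (rule wp_recompute)
          show "env ?r h'" using env' by (simp add: env_def)
          show "index h'" by (rule index')
          show "repr (h' Cur) (S k)" by (rule k(3))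
          show "closing sub A `` S k \<subseteq> S k" unfolding S_def by (rule reach_set_closed)
          show "?r Sym \<in> {1..\<sigma>}" using a by simp
        next
          fix t' r'' h''
          assume *: "frame (recompute sub) ?r h' r'' h''" "repr (h'' Cur) (next_set sub A (?r Sym) (S k))"
            "if next_set sub A (?r Sym) (S k) = S k then h'' Mark = (h' Mark)(?r Sym := 1)
             else \<forall>a\<in>{1..\<sigma>}. h'' Mark a = 0" "t' \<le> t'' + 300 * (n + m + \<sigma> + 1)"
          have marks: "\<forall>b\<in>{1..\<sigma>}. h'' Mark b = 0 \<or> next_set sub A b (S (Suc k)) = S (Suc k)"
            using *(3) k(4) S_Suc by (auto split: if_splits)
          have "credit (h'' Mark) (Suc k) + 1 \<le> credit (h' Mark) k"
          proof (cases "S (Suc k) = S k")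
            case True
            then have "h'' Mark = (h' Mark)(a := 1)" using *(3) S_Suc by simp
            then have "unmarked (h' Mark) = insert a (unmarked (h'' Mark))" "a \<notin> unmarked (h'' Mark)"
              using \<open>h' Mark a = 0\<close> a by (auto simp: unmarked_def)
            with True show ?thesis by (simp add: credit_def fin)
          next
            case False
            have "remaining (S (Suc k)) < remaining (S k)"
              unfolding S_Suc
            proof (rule remaining_next_set)
              show "closing sub A `` S k \<subseteq> S k" "S k \<subseteq> {1..n}"
                unfolding S_def by (rule reach_set_closed reach)+
              show "next_set sub A a (S k) \<subseteq> {1..n}"
                using S_sub[of "Suc k"] unfolding S_Suc .
              show "next_set sub A a (S k) \<noteq> S k" using False unfolding S_Suc .
            qed
            then have "(\<sigma> + 1) * (remaining (S (Suc k)) + 1) \<le> (\<sigma> + 1) * remaining (S k)"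
              by (intro mult_left_mono) auto
            then show ?thesis using unmarked_le[of "h'' Mark"] by (simp add: credit_def)
          qed
          then have "D * (credit (h'' Mark) (Suc k) + 1) \<le> D * credit (h' Mark) k"
            by (intro mult_left_mono) auto
          then have "\<exists>p'. I p' (r''(Pos := Suc (6 + 3 * m + k))) h'' \<and> D + 50 + p' \<le> p"
            using *(2) marks S_Suc by (intro step) simp_all
          moreover have "r'' Pos = 6 + 3 * m + k"
            using *(1) k(2) by (simp add: frame_def recompute_def com_defs)
          ultimately show "wp N L (Assign Pos (Plus (V Pos) (C 1)))
            (\<lambda>t r'' h''. \<exists>p'. I p' r'' h'' \<and> t + p' \<le> p) t' r'' h''"
            using *(4) t'' bounds unfolding D_def by (auto elim!: ex_forward)
        qed
        then show ?thesis
          using True inp bounds k(2) by simp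
      qed
    }
    {
      fix t' assume "\<not> bval r' h' ?g" and t': "t' + p \<le> Suc (Suc t) + ?p + bcost ?g + 1"
      then have "k = length w" using k(1,2) InEnd by simp
      then have "repr (h' Cur) (reach_set sub A w)" using k(3) by (simp add: S_def)
      moreover have "frame (read_word sub) r h r' h'"
        using fr by (auto simp: frame_def read_word_def)
      moreover have "t' \<le> t + 50 * length w + D * (\<sigma> + (\<sigma> + 1) * n) + 50"
        using t' p_le by (simp only: bcost.simps cost.simps)
      ultimately show "Q t' r' h'" unfolding D_def by (intro post)
    }
  qed
  moreover have "r TrEnd = 6 + 3 * m" using env by (simp add: env_def)
  ultimately show ?thesis by (simp add: read_word_def)
qed

lemma wp_start_set:
  assumes env: "env r h" and index: "index h" and zero: "\<forall>q. h New q = 0" "\<forall>q. h Cur q = 0"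
    and post: "\<And>t' r' h'. frame (start_set sub) r h r' h' \<Longrightarrow> repr (h' Cur) (reach_set sub A []) \<Longrightarrow>
      t' \<le> t + 150 * n + 100 * m + 200 \<Longrightarrow> Q t' r' h'"
  shows "wp N L (start_set sub) Q t r h"
proof -
  let ?r = "r(Sp := 1)"
  let ?h = "h(New := (h New)(init A := 1), Stk := (h Stk)(0 := init A))"
  have inp: "h Inp 4 = init A" using env inp_head by (simp add: env_def)
  have env1: "env ?r ?h" and index1: "index ?h"
    using env index by (auto simp: env_def index_def)
  have stack: "stack ?r ?h = {init A}" by (auto simp: stack_def lessThan_Suc)
  have "repr (?h New) {init A}" using zero init by (auto simp: repr_def)
  then have st: "stacked ?r ?h {init A}" using stack by (simp add: stacked_def lessThan_Suc)
  have "wp N L (close_new sub) (wp N L update_cur Q) t1 ?r ?h" if t1: "t1 \<le> t + 50" for t1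
  proof (rule wp_close_new[OF env1 index1 st])
    show "closing sub A `` ({init A} - stack ?r ?h) \<subseteq> {init A}"
      unfolding stack by simp
  next
    fix t2 r2 h2
    assume 2: "frame (close_new sub) ?r ?h r2 h2" "repr (h2 New) ((closing sub A)\<^sup>* `` {init A})"
      "t2 \<le> t1 + 100 * (n + m) + 50"
    have "env r2 h2" using env_frame[OF env1 2(1)] by (simp add: com_defs)
    moreover have "h2 Cur = h Cur" using 2(1) by (simp add: frame_def com_defs)
    \<comment> \<open>The all-zero array represents the empty set, which gives
      \<open>update_cur\<close> its old set.\<close>
    then have "repr (h2 Cur) {}" using zero by (simp add: repr_def)
    ultimately show "wp N L update_cur Q t2 r2 h2"
    proof (rule wp_update_cur[where S' = "(closing sub A)\<^sup>* `` {init A}"])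
      show "repr (h2 New) ((closing sub A)\<^sup>* `` {init A})" by (rule 2(2))
    next
      fix t' r' h'
      assume 3: "frame update_cur r2 h2 r' h'" "repr (h' Cur) ((closing sub A)\<^sup>* `` {init A})"
        "t' \<le> t2 + 50 * n + 50"
      have "frame (start_set sub) r h r' h'"
        using 2(1) 3(1) by (auto simp: frame_def start_set_def)
      then show "Q t' r' h'" using 3(2,3) 2(3) t1 by (intro post) auto
    qed
  qed
  then show ?thesis
    using inp init N_bounds sizes(4) by (simp add: start_set_def)
qed

text \<open>With \<sigma> positive, \<open>n\<close> and \<open>m\<close> are positive as well. So
  \<open>n * \<sigma> * m\<close> is at least \<open>m\<close> and at least 1, and absorbs the cost
  of the index, of the first search and of all additive constants.\<close>

lemma wp_matcher:
  assumes pos: "0 < \<sigma>" and inp: "h Inp = inp" and zero: "\<And>a i. a \<noteq> Inp \<Longrightarrow> h a i = 0"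
  shows "wp N L (matcher sub)
    (\<lambda>t r' h'. t \<le> 10000 * (length w + n * \<sigma> * m) \<and> r' Ans = of_bool (final A \<in> reach_set sub A w)) 0 r h"
proof -
  define Q where "Q t r' h' \<longleftrightarrow>
      t \<le> 10000 * (length w + n * \<sigma> * m) \<and> r' Ans = of_bool (final A \<in> reach_set sub A w)"
    for t :: nat and r' :: store and h' :: heap
  define Y Z where "Y = n * \<sigma> * m" and "Z = 400 * (n + m + \<sigma> + 1) * (\<sigma> + (\<sigma> + 1) * n)"
  let ?r = "r(NumQ := n, TrEnd := 6 + (m + (m + m)), InEnd := 6 + (m + (m + m)) + length w)"
  have n: "0 < n" using init by simp
  have m: "0 < m" using pos sizes(2) by simp
  have "n * \<sigma> * m \<ge> 1 * 1 * m" using n pos by (intro mult_mono) auto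
  then have m_le: "m \<le> Y" by (simp add: Y_def)
  have "\<sigma> + (\<sigma> + 1) * n \<le> 3 * (n * \<sigma>)"
  proof -
    have "\<sigma> \<le> n * \<sigma>" "n \<le> n * \<sigma>" using n pos by simp_all
    moreover have "\<sigma> + (\<sigma> + 1) * n = \<sigma> + n + n * \<sigma>" by (simp add: algebra_simps)
    ultimately show ?thesis by linarith
  qed
  moreover have "n + m + \<sigma> + 1 \<le> 5 * m" using sizes(1,2) m by simp
  ultimately have "(n + m + \<sigma> + 1) * (\<sigma> + (\<sigma> + 1) * n) \<le> 5 * m * (3 * (n * \<sigma>))"
    by (rule mult_le_mono[rotated])
  \<comment> \<open>6000 is 400 * 5 * 3, from the cost of one recomputation and the two preceding
    estimates.\<close>
  then have main: "Z \<le> 6000 * Y"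
    by (simp add: Y_def Z_def algebra_simps)
  have env: "env ?r h" unfolding env_def using inp sizes(3) by simp
  have "wp N L build_index (wp N L (start_set sub) (wp N L (read_word sub)
      (wp N L (Assign Ans (Rd Cur (Rd Inp (C 5)))) Q))) t0 ?r h" if t0: "t0 \<le> 100" for t0
  proof (rule wp_build_index[OF env])
    show "\<forall>q\<in>{1..n}. h Head q = 0" using zero by simp
  next
    fix t1 r1 h1 assume 1: "frame build_index ?r h r1 h1" "index h1" "t1 \<le> t0 + 50 * m + 10"
    have f1: "env r1 h1" "h1 New = h New" "h1 Cur = h Cur" "h1 Mark = h Mark"
      using env_frame[OF env 1(1)] 1(1) by (auto simp: frame_def build_index_def)
    show "wp N L (start_set sub) (wp N L (read_word sub)
      (wp N L (Assign Ans (Rd Cur (Rd Inp (C 5)))) Q)) t1 r1 h1"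
    proof (rule wp_start_set[OF f1(1) 1(2)])
      show "\<forall>q. h1 New q = 0" "\<forall>q. h1 Cur q = 0" using f1 zero by simp_all
    next
      fix t2 r2 h2
      assume 2: "frame (start_set sub) r1 h1 r2 h2" "repr (h2 Cur) (reach_set sub A [])"
        "t2 \<le> t1 + 150 * n + 100 * m + 200"
      have f2: "env r2 h2" "index h2" "h2 Mark = h Mark"
        using env_frame[OF f1(1) 2(1)] index_frame[OF 1(2) 2(1)] 2(1) f1(4)
        by (auto simp: frame_def start_set_def com_defs)
      show "wp N L (read_word sub) (wp N L (Assign Ans (Rd Cur (Rd Inp (C 5)))) Q) t2 r2 h2"
      proof (rule wp_read_word[OF f2(1,2) 2(2)])
        show "\<forall>a\<in>{1..\<sigma>}. h2 Mark a = 0" using f2 zero by simp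
      next
        fix t3 r3 h3
        assume 3: "frame (read_word sub) r2 h2 r3 h3" "repr (h3 Cur) (reach_set sub A w)"
          "t3 \<le> t2 + 50 * length w + 400 * (n + m + \<sigma> + 1) * (\<sigma> + (\<sigma> + 1) * n) + 50"
        have "env r3 h3"
          using env_frame[OF f2(1) 3(1)] by (simp add: read_word_def recompute_def com_defs)
        then have "h3 Inp 5 = final A" using inp_head by (simp add: env_def)
        moreover have "h3 Cur (final A) = of_bool (final A \<in> reach_set sub A w)"
          using 3(2) final by (simp add: repr_def)
        moreover have "t3 + 10 \<le> 520 + 300 * m + 50 * length w + 6000 * Y"
          using 3(3)[folded Z_def] 2(3) 1(3) t0 main sizes(1) by simp
        then have "t3 + 10 \<le> 10000 * (length w + Y)"
          using m_le m by simp
        ultimately show "wp N L (Assign Ans (Rd Cur (Rd Inp (C 5)))) Q t3 r3 h3"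
          using final N_bounds sizes(4) by (simp add: Q_def Y_def)
      qed
    qed
  qed
  moreover have "h Inp 0 = n" "h Inp (Suc 0) = \<sigma>" "h Inp 2 = m" "h Inp 3 = length w"
    using inp inp_head by simp_all
  ultimately have "wp N L (matcher sub) Q 0 r h"
    using pos N_bounds sizes by (simp add: matcher_def)
  then show ?thesis unfolding Q_def .
qed

end

section \<open>Encoded instances\<close>

lemma length_concat_encode: "length (concat (map encode_transition ts)) = 3 * length ts"
  by (induction ts) auto

lemma nth_concat_encode:
  "t < length ts \<Longrightarrow> j < 3 \<Longrightarrow>
     concat (map encode_transition ts) ! (3 * t + j) = encode_transition (ts ! t) ! j"
proof (induction ts arbitrary: t)
  case (Cons x ts)
  have len: "length (encode_transition x) = 3" by (cases x) auto
  show ?case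
  proof (cases t)
    case 0
    with Cons.prems len show ?thesis by (simp add: nth_append)
  next
    case (Suc t')
    with Cons.prems Cons.IH[of t'] len show ?thesis by (simp add: nth_append)
  qed
qed simp

lemma path_symbols: "path A p u q \<Longrightarrow> enfa A \<Longrightarrow> set u \<subseteq> alphabet A"
  by (induction rule: path.induct) (auto simp: enfa_def)

lemma final_reachable_if_no_symbols:
  assumes "enfa A" "trimmed A" "alphabet A = {}"
  shows "final A \<in> reach_set sub A []"
proof -
  have "final A \<in> states A" using assms(1) by (simp add: enfa_def)
  then obtain u where u: "path A (init A) u (final A)"
    using assms(2) by (auto simp: trimmed_def)
  with path_symbols[OF u assms(1)] assms(3) have "path A (init A) [] (final A)" by simp
  then show ?thesis
    by (cases sub) (auto simp del: reach_set_Nil simp: reach_set_sub reach_set_super)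
qed

text \<open>Turns the logarithmic word size into a polynomial bound. The exponent 3 suffices since
  \<open>N \<ge> 6\<close> gives \<open>N ^ 3 \<ge> 36 * N\<close>, more than the
  \<open>7 * N\<close> addresses in use.\<close>

lemma cube_le_two_power:
  assumes "real 3 * log 2 (real k) \<le> real b" "0 < k"
  shows "k ^ 3 \<le> 2 ^ b"
proof -
  have "log 2 (real k ^ 3) \<le> real b"
    using assms by (simp add: log_nat_power)
  then have "real k ^ 3 \<le> 2 powr real b"
    using assms(2) by (simp add: log_le_iff)
  also have "\<dots> = 2 ^ b" by (simp add: powr_realpow)
  finally have "real (k ^ 3) \<le> real (2 ^ b)" by simp
  then show ?thesis by (simp only: of_nat_le_iff)
qed

definition label_code :: "nat option \<Rightarrow> nat" where
  "label_code x = (case x of None \<Rightarrow> 0 | Some a \<Rightarrow> a)"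

lemma encode_transition_eq: "encode_transition e = [fst e, label_code (fst (snd e)), snd (snd e)]"
  by (cases e) (simp add: label_code_def)

text \<open>The summand 20 covers the ten steps outside the compiled command and, over the empty
  alphabet, also the nine steps of the first test and its answer.\<close>

lemma answers_within_matcher:
  assumes inst: "matching_instance A ts w"
    and b: "real 3 * log 2 (real (length (encode_instance A ts w))) \<le> real b"
    and T: "10000 * (length w + card (states A) * card (alphabet A) * card (trans A)) + 20 \<le> T"
  shows "answers_within b (compile_program (matcher sub)) (encode_instance A ts w) T
    (final A \<in> reach_set sub A w)"
proof -
  define n \<sigma> m where "n = card (states A)" and "\<sigma> = card (alphabet A)" and "m = length ts"
  define xs where "xs = encode_instance A ts w"
  define N where "N = length xs"
  define src lab tgt where "src t = fst (ts ! t)" and "lab t = label_code (fst (snd (ts ! t)))"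
    and "tgt t = snd (snd (ts ! t))" for t
  define inp where "inp = input_heap xs Inp"
  have A: "enfa A" "trimmed A" "all_symbols_used A" "states A = {1..n}" "alphabet A = {1..\<sigma>}"
      "set ts = trans A" "w \<in> lists (alphabet A)"
    and m: "m = card (trans A)"
    using inst distinct_card[of ts] unfolding matching_instance_def n_def \<sigma>_def m_def by auto
  have N: "N = 6 + 3 * m + length w"
    by (simp add: N_def xs_def encode_instance_def length_concat_encode m_def)
  have sizes: "n \<le> Suc m" "\<sigma> \<le> m"
    using card_states_le[OF A(1,2)] card_alphabet_le[OF A(1,3)] by (simp_all add: n_def \<sigma>_def m)
  have large: "7 * N \<le> 2 ^ b"
  proof -
    have "N ^ 3 \<le> 2 ^ b" using b N by (intro cube_le_two_power) (simp_all add: N_def xs_def)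
    moreover have "6 * 6 * N \<le> N * N * N" using N by (intro mult_mono) auto
    ultimately show ?thesis unfolding power3_eq_cube by linarith
  qed
  have xs: "xs = [n, \<sigma>, m, length w, init A, final A] @ concat (map encode_transition ts) @ w"
    by (simp add: xs_def encode_instance_def n_def \<sigma>_def m_def)
  have edge: "(src t, fst (snd (ts ! t)), tgt t) \<in> trans A" if "t < m" for t
    using that A(6) nth_mem[of t ts] by (simp add: src_def tgt_def m_def)
  have edge_states: "src t \<in> {1..n}" "tgt t \<in> {1..n}" if "t < m" for t
    using trans_in_states[OF A(1) edge[OF that]] A(4) by simp_all
  have edge_label: "fst (snd (ts ! t)) \<in> insert None (Some ` {1..\<sigma>})" if "t < m" for t
    using A(1,5) edge[OF that] unfolding enfa_def by auto
  have trans_iff: "(p, x, q) \<in> trans A \<longleftrightarrow> (\<exists>t<m. src t = p \<and> fst (snd (ts ! t)) = x \<and> tgt t = q)" for p x q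
    unfolding A(6)[symmetric] in_set_conv_nth by (auto simp: src_def tgt_def m_def)
  \<comment> \<open>Symbols are positive, so the code 0 belongs to the empty label alone.\<close>
  have lab_None: "lab t = 0 \<longleftrightarrow> fst (snd (ts ! t)) = None" if "t < m" for t
    using edge_label[OF that] by (auto simp: lab_def label_code_def)
  have lab_Some: "lab t = a \<longleftrightarrow> fst (snd (ts ! t)) = Some a" if "t < m" "0 < a" for t a
    using edge_label[OF that(1)] that(2) by (auto simp: lab_def label_code_def)
  have states: "init A \<in> {1..n}" "final A \<in> {1..n}"
    using A(1,4) by (simp_all add: enfa_def)
  have word: "w ! k \<in> {1..\<sigma>}" if "k < length w" for k
    using A(5,7) that by (auto simp: in_lists_conv_set)
  have inp_trans: "inp (6 + 3 * t + j) = encode_transition (ts ! t) ! j" if "t < m" "j < 3" for t j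
    using that nth_concat_encode[of t ts j]
    by (simp add: inp_def input_heap_def xs nth_append length_concat_encode m_def)
  have "xs ! 2 = m" "xs ! 3 = length w" by (simp_all add: xs)
  then have len: "length xs = 6 + 3 * xs ! 2 + xs ! 3" using N by (simp add: N_def)
  have small: "xs ! i < 2 ^ b" if "i < length xs" for i
  proof -
    \<comment> \<open>Counts, states and symbols are all bounded by the length of the input, so
      every input cell fits into a word.\<close>
    have "x \<le> N" if "x \<in> set xs" for x
    proof -
      from that consider "x \<in> {n, \<sigma>, m, length w, init A, final A}" | "x \<in> set w"
        | t where "t < m" "x \<in> {src t, lab t, tgt t}"
        unfolding xs encode_transition_eq src_def lab_def tgt_def m_def
        by (auto simp: in_set_conv_nth[of _ ts])
      then show ?thesis
      proof cases
        case 1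
        then show ?thesis using sizes states N by auto
      next
        case 2
        then show ?thesis using word sizes N by (force simp: in_set_conv_nth)
      next
        case 3
        then have "lab t \<le> \<sigma>" using edge_label[OF 3(1)] by (auto simp: lab_def label_code_def)
        then show ?thesis using 3 edge_states[OF 3(1)] sizes N by auto
      qed
    qed
    then have "xs ! i \<le> N" using that by simp
    then show ?thesis using large N by simp
  qed
  have wp: "wp N (2 ^ b) (matcher sub)
      (\<lambda>t r' h'. t + 10 \<le> T \<and> r' Ans = of_bool (final A \<in> reach_set sub A w)) 0 r (input_heap xs)" for r
  proof (cases "\<sigma> = 0")
    case True
    then have "w = []" "alphabet A = {}" using A(5,7) by auto
    then have "final A \<in> reach_set sub A w"
      using final_reachable_if_no_symbols[OF A(1,2)] by simp
    moreover have "input_heap xs Inp (Suc 0) = 0" using True by (simp add: input_heap_def xs)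
    ultimately show ?thesis
      using T large N by (simp add: matcher_def)
  next
    case False
    interpret encoded_instance sub A w inp src lab tgt n \<sigma> m N "2 ^ b"
    proof
      show "inp 0 = n" "inp 1 = \<sigma>" "inp 2 = m" "inp 3 = length w" "inp 4 = init A" "inp 5 = final A"
        by (simp_all add: inp_def input_heap_def xs)
      show "inp (6 + 3 * t) = src t" "inp (6 + 3 * t + 1) = lab t" "inp (6 + 3 * t + 2) = tgt t"
        if "t < m" for t
        using inp_trans[OF that, of 0] inp_trans[OF that, of 1] inp_trans[OF that, of 2]
        by (simp_all add: encode_transition_eq src_def lab_def tgt_def)
      show "inp (6 + 3 * m + k) = w ! k" if "k < length w" for k
        using that by (simp add: inp_def input_heap_def xs nth_append length_concat_encode m_def)
      show "reach_set sub A v \<subseteq> {1..n}" for v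
        using reach_set_subset[OF A(1)] A(4) by simp
      show "(p, q) \<in> closing sub A \<longleftrightarrow> (\<exists>t<m. src t = p \<and> tgt t = q \<and> (sub \<longrightarrow> lab t = 0))" for p q
        unfolding closing_def trans_iff using lab_None by auto
      show "succs A a S = {tgt t |t. t < m \<and> lab t = a \<and> src t \<in> S}" if "0 < a" for a S
        unfolding succs_def trans_iff using lab_Some[OF _ that] by auto
    qed (use edge_states word states sizes N large in auto)
    show ?thesis
    proof (rule wp_conseq[OF wp_matcher])
      show "0 < \<sigma>" using False by simp
      show "input_heap xs Inp = inp" by (simp add: inp_def)
      show "input_heap xs a i = 0" if "a \<noteq> Inp" for a i
        using that by (cases a) (simp_all add: input_heap_def)
    qed (use T in \<open>simp add: n_def \<sigma>_def m\<close>)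
  qed
  show ?thesis
    unfolding xs_def[symmetric]
    by (rule answers_within_compile_program[OF len])
      (use large small wp in \<open>simp_all add: N_def\<close>)
qed

text \<open>Both problems are solved within the sharper bound; the second assumption relaxes it to
  the one claimed.\<close>

lemma solvable_in_O_reach_set:
  assumes "\<And>(A :: (nat, nat) enfa) w. problem A w \<longleftrightarrow> final A \<in> reach_set sub A w"
    and "\<And>n \<sigma> m l. l + n * \<sigma> * m \<le> T n \<sigma> m l"
  shows "solvable_in_O problem T"
  unfolding solvable_in_O_def
proof (intro exI allI impI)
  fix A :: "(nat, nat) enfa" and ts and w :: "nat list" and b :: nat
  let ?x = "T (card (states A)) (card (alphabet A)) (card (trans A)) (length w)"
  assume inst: "matching_instance A ts w"
    "real 3 * log 2 (real (length (encode_instance A ts w))) \<le> real b"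
  have "length w + card (states A) * card (alphabet A) * card (trans A) \<le> max 1 ?x"
    "1 \<le> max 1 ?x"
    using assms(2)[of "length w" "card (states A)" "card (alphabet A)" "card (trans A)"] by simp_all
  \<comment> \<open>The maximum with 1 absorbs the additive 20 at the price of doubling the
    constant.\<close>
  moreover have "10000 * y + 20 \<le> 20000 * x" if "y \<le> x" "1 \<le> x" for x y :: nat
    using that by simp
  ultimately have "10000 * (length w + card (states A) * card (alphabet A) * card (trans A)) + 20
      \<le> 20000 * max 1 ?x"
    by blast
  with inst show "answers_within b (compile_program (matcher sub)) (encode_instance A ts w)
      (20000 * max 1 ?x) (problem A w)"
    unfolding assms(1) by (rule answers_within_matcher)
qed

theorem theorem3p5:
  "solvable_in_O subsequence_matching (\<lambda>n \<sigma> m l. l + n * \<sigma> * (n * \<sigma> + m)) \<and>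
   solvable_in_O supersequence_matching (\<lambda>n \<sigma> m l. l + n * \<sigma> * m)"
  using matching_iff_reach_set
  by (intro conjI solvable_in_O_reach_set[where sub = True] solvable_in_O_reach_set[where sub = False]) simp_all

end
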